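(* Let $E$ be an element of a mesh satisfying the mesh assumptions (M1)-(M2) and let $\widetilde\Pi^E:V_h(E)\to\mathbb P_1(E)$ be the projection operator defined by $[v_h-\widetilde\Pi^Ev_h,q]_E=0$ for all $q\in\mathbb P_1(E)$. Then: (i) $\widetilde\Pi^E$ is invariant on the linear polynomials, i.e. $\widetilde\Pi^Eq=q$ for every $q\in\mathbb P_1(E)$, and thus idempotent, i.e. $(\widetilde\Pi^E)^2=\widetilde\Pi^E$; (ii) $\widetilde\Pi^E$ is bounded in $L^2(E)$, i.e. $\|\widetilde\Pi^Ev_h\|_{0,E}\le C\|v_h\|_{0,E}$ for every $v_h\in V_h(E)$ and some real, positive constant $C$ independent of $h_E$.
   Context: $E\subset\mathbb R^2$ is an open polygon with nonintersecting boundary made of straight edges $e$, area $|E|$, diameter $h_E$ and vertices $x_1,\dots,x_{N^E}$. For a fixed $\rho>0$ (independent of the mesh size): (M1) $E$ is star-shaped with respect to a ball of radius greater than $\rho h_E$; (M2) every edge of $E$ has length at least $\rho h_E$. $\mathbb P_1(E)$ is the space of polynomials of degree at most $1$ on $E$. $V_h(E)=\{v_h\in H^1(E)\cap C(\overline E): v_h|_{\partial E}\in C(\partial E),\ v_h|_e\in\mathbb P_1(e)\ \forall e\subset\partial E,\ \Delta v_h=0\text{ in }E\}$, which contains $\mathbb P_1(E)$. $[v_h,w_h]_E=|E|\sum_{i=1}^{N^E}v_h(x_i)w_h(x_i)$. $\|\cdot\|_{0,E}$ is the $L^2(E)$ norm. Constants $C$ may depend on the mesh regularity constant $\rho$. 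*)

theory Defs
  imports "HOL-Analysis.Analysis"
begin

section \<open>Polygons\<close>

text \<open>
  A polygon is given by the list \<open>xs\<close> of its vertices in cyclic order. Two different edges of
  the closed polygonal line may only meet in a vertex that they share. Straight angles between
  consecutive edges are not excluded.
\<close>

definition edge :: "(real^2) list \<Rightarrow> nat \<Rightarrow> (real^2) set" where
  "edge xs i = closed_segment (xs ! i) (xs ! (Suc i mod length xs))"

definition edge_ends :: "(real^2) list \<Rightarrow> nat \<Rightarrow> (real^2) set" where
  "edge_ends xs i = {xs ! i, xs ! (Suc i mod length xs)}"

definition nonintersecting :: "(real^2) list \<Rightarrow> bool" where
  "nonintersecting xs \<longleftrightarrow>
     (\<forall>i<length xs. \<forall>j<length xs. i \<noteq> j \<longrightarrow> edge xs i \<inter> edge xs j = edge_ends xs i \<inter> edge_ends xs j)"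

definition is_polygon :: "(real^2) set \<Rightarrow> (real^2) list \<Rightarrow> bool" where
  "is_polygon E xs \<longleftrightarrow>
     length xs \<ge> 3 \<and> distinct xs \<and> nonintersecting xs \<and> E = inside (\<Union>i<length xs. edge xs i)"

definition star_shaped_wrt :: "(real^2) set \<Rightarrow> (real^2) set \<Rightarrow> bool" where
  "star_shaped_wrt E B \<longleftrightarrow> (\<forall>a\<in>B. a \<in> E \<and> (\<forall>y\<in>E. closed_segment a y \<subseteq> E))"

definition mesh_M1 :: "real \<Rightarrow> (real^2) set \<Rightarrow> bool" where
  "mesh_M1 \<rho> E \<longleftrightarrow> (\<exists>c r. r > \<rho> * diameter E \<and> star_shaped_wrt E (ball c r))"

definition mesh_M2 :: "real \<Rightarrow> (real^2) set \<Rightarrow> (real^2) list \<Rightarrow> bool" where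
  "mesh_M2 \<rho> E xs \<longleftrightarrow>
     (\<forall>i<length xs. dist (xs ! i) (xs ! (Suc i mod length xs)) \<ge> \<rho> * diameter E)"

definition mesh_element :: "real \<Rightarrow> (real^2) set \<Rightarrow> (real^2) list \<Rightarrow> bool" where
  "mesh_element \<rho> E xs \<longleftrightarrow> is_polygon E xs \<and> mesh_M1 \<rho> E \<and> mesh_M2 \<rho> E xs"


section \<open>Function spaces\<close>

definition partial_deriv :: "2 \<Rightarrow> (real^2 \<Rightarrow> real) \<Rightarrow> real^2 \<Rightarrow> real" where
  "partial_deriv i f x = frechet_derivative f (at x) (axis i 1)"

primrec Ck :: "nat \<Rightarrow> (real^2 \<Rightarrow> real) \<Rightarrow> bool" where
  "Ck 0 f \<longleftrightarrow> continuous_on UNIV f"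
| "Ck (Suc k) f \<longleftrightarrow> (\<forall>x. f differentiable (at x)) \<and> (\<forall>i. Ck k (partial_deriv i f))"

definition test_function :: "(real^2) set \<Rightarrow> (real^2 \<Rightarrow> real) \<Rightarrow> bool" where
  "test_function E \<phi> \<longleftrightarrow> (\<forall>k. Ck k \<phi>) \<and>
     compact (closure {x. \<phi> x \<noteq> 0}) \<and> closure {x. \<phi> x \<noteq> 0} \<subseteq> E"

definition L2 :: "(real^2) set \<Rightarrow> (real^2 \<Rightarrow> real) set" where
  "L2 E = {v. set_borel_measurable lebesgue E v \<and> set_integrable lebesgue E (\<lambda>x. (v x)\<^sup>2)}"

definition L2_norm :: "(real^2) set \<Rightarrow> (real^2 \<Rightarrow> real) \<Rightarrow> real" where
  "L2_norm E v = sqrt (LINT x:E|lebesgue. (v x)\<^sup>2)"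

definition weak_partial :: "(real^2) set \<Rightarrow> 2 \<Rightarrow> (real^2 \<Rightarrow> real) \<Rightarrow> (real^2 \<Rightarrow> real) \<Rightarrow> bool" where
  "weak_partial E i v g \<longleftrightarrow>
     (\<forall>\<phi>. test_function E \<phi> \<longrightarrow>
        (LINT x:E|lebesgue. v x * partial_deriv i \<phi> x) = - (LINT x:E|lebesgue. g x * \<phi> x))"

definition H1 :: "(real^2) set \<Rightarrow> (real^2 \<Rightarrow> real) set" where
  "H1 E = {v \<in> L2 E. \<forall>i. \<exists>g\<in>L2 E. weak_partial E i v g}"

text \<open>
  The elements of \<open>H1 E\<close> need not have classical second derivatives, so the equation
  \<open>\<Delta>v = 0\<close> is understood in the sense of distributions.
\<close>

definition laplacian :: "(real^2 \<Rightarrow> real) \<Rightarrow> real^2 \<Rightarrow> real" where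
  "laplacian \<phi> x = (\<Sum>i\<in>UNIV. partial_deriv i (partial_deriv i \<phi>) x)"

definition harmonic_in :: "(real^2) set \<Rightarrow> (real^2 \<Rightarrow> real) \<Rightarrow> bool" where
  "harmonic_in E v \<longleftrightarrow> (\<forall>\<phi>. test_function E \<phi> \<longrightarrow> (LINT x:E|lebesgue. v x * laplacian \<phi> x) = 0)"

text \<open>
  Polynomials of degree at most one are represented by functions on the whole plane. Restriction
  to a set with nonempty interior is injective on them, so that equality of such functions is
  equality on \<open>E\<close>.
\<close>

definition P1 :: "(real^2 \<Rightarrow> real) set" where
  "P1 = {q. \<exists>a b. q = (\<lambda>x. a + b \<bullet> x)}"

text \<open>
  Elements of the local space are total functions of which only the values on \<open>closure E\<close>
  matter.
\<close>

definition V_h :: "(real^2) set \<Rightarrow> (real^2) list \<Rightarrow> (real^2 \<Rightarrow> real) set" where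
  "V_h E xs = {v. v \<in> H1 E \<and> continuous_on (closure E) v \<and> continuous_on (frontier E) v \<and>
     (\<forall>i<length xs. \<exists>q\<in>P1. \<forall>y\<in>edge xs i. v y = q y) \<and> harmonic_in E v}"


section \<open>The projection\<close>

definition vertex_ip ::
    "(real^2) set \<Rightarrow> (real^2) list \<Rightarrow> (real^2 \<Rightarrow> real) \<Rightarrow> (real^2 \<Rightarrow> real) \<Rightarrow> real" where
  "vertex_ip E xs v w = measure lebesgue E * (\<Sum>i<length xs. v (xs ! i) * w (xs ! i))"

text \<open>
  The description is proper on every mesh element: see \<open>Pi_tilde_ex1\<close> and
  \<open>Pi_tilde_projection\<close> below.
\<close>

definition Pi_tilde ::
    "(real^2) set \<Rightarrow> (real^2) list \<Rightarrow> (real^2 \<Rightarrow> real) \<Rightarrow> (real^2 \<Rightarrow> real)" where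
  "Pi_tilde E xs v =
     (THE p. p \<in> P1 \<and> (\<forall>q\<in>P1. vertex_ip E xs (\<lambda>x. v x - p x) q = 0))"

lemma mesh_element_ball:
  assumes "mesh_element \<rho> E xs" "\<rho> > 0"
  obtains c r where "r > 0" "ball c r \<subseteq> E"
proof -
  obtain c r where *: "r > \<rho> * diameter E" "star_shaped_wrt E (ball c r)"
    using assms unfolding mesh_element_def mesh_M1_def by blast
  have "compact (\<Union>i<length xs. edge xs i)"
    by (intro compact_UN) (auto simp: edge_def)
  then have "bounded E"
    using assms compact_imp_bounded unfolding mesh_element_def is_polygon_def
    by (metis bounded_inside)
  then have "diameter E \<ge> 0"
    by (rule diameter_ge_0)
  with * assms(2) have "r > 0"
    by (smt (verit) mult_nonneg_nonneg)
  moreover have "ball c r \<subseteq> E"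
    using *(2) unfolding star_shaped_wrt_def by blast
  ultimately show ?thesis using that by blast
qed

lemma mesh_element_measure_pos:
  assumes "mesh_element \<rho> E xs" "\<rho> > 0"
  shows "measure lebesgue E > 0"
proof -
  obtain c r where cr: "r > 0" "ball c r \<subseteq> E"
    using mesh_element_ball[OF assms] .
  have c: "compact (\<Union>i<length xs. edge xs i)"
    by (intro compact_UN) (auto simp: edge_def)
  have E: "E = inside (\<Union>i<length xs. edge xs i)"
    using assms(1) unfolding mesh_element_def is_polygon_def by blast
  have "open E" "bounded E"
    using c E by (simp_all add: bounded_inside compact_imp_bounded compact_imp_closed open_inside)
  then have "E \<in> lmeasurable"
    by (rule lmeasurable_open[rotated])
  then have "measure lebesgue (ball c r) \<le> measure lebesgue E"
    using cr by (intro measure_mono_fmeasurable) auto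
  moreover have "measure lebesgue (ball c r) > 0"
    using cr(1) content_ball_pos[of r c] by (simp add: measure_completion)
  ultimately show ?thesis by linarith
qed

lemma mesh_element_affine_zero:
  assumes "mesh_element \<rho> E xs" "\<rho> > 0"
    and zero: "\<forall>i<length xs. a + b \<bullet> (xs ! i) = 0"
  shows "a = 0 \<and> b = 0"
proof -
  let ?H = "{x. b \<bullet> x = - a}"
  obtain c r where cr: "r > 0" "ball c r \<subseteq> E"
    using mesh_element_ball[OF assms(1,2)] .
  have vert: "xs ! i \<in> ?H" if "i < length xs" for i
    using zero that by (simp add: algebra_simps eq_neg_iff_add_eq_0)
  have "convex ?H" by (rule convex_hyperplane)
  moreover have "edge xs i \<subseteq> ?H" if "i < length xs" for i
  proof -
    have "Suc i mod length xs < length xs"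
      using that by (intro mod_less_divisor) linarith
    then show ?thesis
      unfolding edge_def using that vert \<open>convex ?H\<close> by (intro closed_segment_subset) blast+
  qed
  then have "(\<Union>i<length xs. edge xs i) \<subseteq> ?H" by blast
  ultimately have "- ?H \<subseteq> outside (\<Union>i<length xs. edge xs i)"
    by (intro outside_subset_convex)
  then have "inside (\<Union>i<length xs. edge xs i) \<subseteq> ?H"
    using inside_Int_outside[of "\<Union>i<length xs. edge xs i"] by blast
  then have "E \<subseteq> ?H"
    using assms(1) unfolding mesh_element_def is_polygon_def by blast
  then have sub: "ball c r \<subseteq> ?H" using cr by blast
  have b: "b = 0"
  proof (rule ccontr)
    assume "b \<noteq> 0"
    then have "interior ?H = {}" by (rule interior_hyperplane)
    then show False using sub cr(1) interior_maximal[OF sub open_ball] by auto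
  qed
  have "c \<in> ?H" using sub cr(1) by (meson centre_in_ball subsetD)
  with b show ?thesis by (simp split: if_splits)
qed

lemma Pi_tilde_ex1:
  assumes "mesh_element \<rho> E xs" "\<rho> > 0"
  shows "\<exists>!p. p \<in> P1 \<and> (\<forall>q\<in>P1. vertex_ip E xs (\<lambda>x. v x - p x) q = 0)"
proof -
  let ?N = "length xs"
  have area: "measure lebesgue E \<noteq> 0"
    using mesh_element_measure_pos[OF assms] by simp
  define T :: "real \<times> (real^2) \<Rightarrow> real \<times> (real^2)" where
    "T = (\<lambda>(a, b). (\<Sum>i<?N. a + b \<bullet> (xs ! i), \<Sum>i<?N. (a + b \<bullet> (xs ! i)) *\<^sub>R (xs ! i)))"
  have lin: "linear T"
    by (rule linearI)
      (auto simp: T_def sum.distrib[symmetric] scaleR_sum_right sum_distrib_left algebra_simps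
        inner_add_left intro!: sum.cong)
  have inner_T: "(a', b') \<bullet> T (a, b) = (\<Sum>i<?N. (a + b \<bullet> (xs ! i)) * (a' + b' \<bullet> (xs ! i)))"
    for a a' b b'
    by (simp add: T_def inner_sum_right sum_distrib_left sum.distrib[symmetric] algebra_simps)
  have inj: "inj T"
  proof (subst linear_injective_0[OF lin], intro allI impI)
    fix z assume "T z = 0"
    obtain a b where z: "z = (a, b)" by (cases z)
    have "(\<Sum>i<?N. (a + b \<bullet> (xs ! i)) * (a + b \<bullet> (xs ! i))) = 0"
      using inner_T[of a b a b] \<open>T z = 0\<close> z by simp
    then have "\<forall>i<?N. a + b \<bullet> (xs ! i) = 0"
      by (subst (asm) sum_nonneg_eq_0_iff) auto
    then show "z = 0"
      using mesh_element_affine_zero[OF assms] z by (simp add: zero_prod_def)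
  qed
  then have surj: "surj T"
    using linear_injective_imp_surjective[OF lin] inj by simp
  have orth: "(\<forall>q\<in>P1. vertex_ip E xs (\<lambda>x. v x - (a + b \<bullet> x)) q = 0) \<longleftrightarrow>
      T (a, b) = (\<Sum>i<?N. v (xs ! i), \<Sum>i<?N. v (xs ! i) *\<^sub>R (xs ! i))" (is "?L \<longleftrightarrow> _ = ?R")
    for a b
  proof -
    have R: "(a', b') \<bullet> ?R = (\<Sum>i<?N. v (xs ! i) * (a' + b' \<bullet> (xs ! i)))" for a' b'
      by (simp add: inner_sum_right sum_distrib_left sum.distrib[symmetric] algebra_simps)
    have "?L \<longleftrightarrow> (\<forall>a' b'. vertex_ip E xs (\<lambda>x. v x - (a + b \<bullet> x)) (\<lambda>x. a' + b' \<bullet> x) = 0)"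
      unfolding P1_def by blast
    also have "\<dots> \<longleftrightarrow> (\<forall>a' b'. (a', b') \<bullet> (?R - T (a, b)) = 0)"
      unfolding inner_diff_right[of "(_, _)" ?R] R inner_T vertex_ip_def
      using area by (simp add: left_diff_distrib sum_subtractf)
    also have "\<dots> \<longleftrightarrow> ?R - T (a, b) = 0"
    proof (intro iffI allI)
      assume *: "\<forall>a' b'. (a', b') \<bullet> (?R - T (a, b)) = 0"
      obtain y z where yz: "?R - T (a, b) = (y, z)" by fastforce
      with * have "(y, z) \<bullet> (y, z) = 0" by simp
      then show "?R - T (a, b) = 0" unfolding yz by (simp only: inner_eq_zero_iff)
    qed simp
    finally show ?thesis by auto
  qed
  show ?thesis
  proof (rule ex_ex1I)
    obtain a b where "T (a, b) = (\<Sum>i<?N. v (xs ! i), \<Sum>i<?N. v (xs ! i) *\<^sub>R (xs ! i))"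
      using surjD[OF surj, of "(\<Sum>i<?N. v (xs ! i), \<Sum>i<?N. v (xs ! i) *\<^sub>R (xs ! i))"] by fastforce
    then show "\<exists>p. p \<in> P1 \<and> (\<forall>q\<in>P1. vertex_ip E xs (\<lambda>x. v x - p x) q = 0)"
      using orth[of a b] by (intro exI[of _ "\<lambda>x. a + b \<bullet> x"]) (auto simp: P1_def)
  next
    fix p p'
    assume p: "p \<in> P1 \<and> (\<forall>q\<in>P1. vertex_ip E xs (\<lambda>x. v x - p x) q = 0)"
      and p': "p' \<in> P1 \<and> (\<forall>q\<in>P1. vertex_ip E xs (\<lambda>x. v x - p' x) q = 0)"
    obtain a b where ab: "p = (\<lambda>x. a + b \<bullet> x)" using p unfolding P1_def by blast
    obtain a' b' where ab': "p' = (\<lambda>x. a' + b' \<bullet> x)" using p' unfolding P1_def by blast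
    have "T (a, b) = T (a', b')"
      using p p' orth[of a b] orth[of a' b'] unfolding ab ab' by simp
    then have "(a, b) = (a', b')" using inj by (rule injD[rotated])
    then show "p = p'" using ab ab' by simp
  qed
qed

lemma Pi_tilde_projection:
  assumes "mesh_element \<rho> E xs" "\<rho> > 0"
  shows "Pi_tilde E xs v \<in> P1"
    and "q \<in> P1 \<Longrightarrow> vertex_ip E xs (\<lambda>x. v x - Pi_tilde E xs v x) q = 0"
  using theI'[OF Pi_tilde_ex1[OF assms, of v]] unfolding Pi_tilde_def by blast+

end

theory Submission
  imports Defs
begin

text \<open>
  Invariance on \<open>P1\<close> is uniqueness of the orthogonal projection. The substance of the theorem is the
  \<open>L2\<close> bound with a constant that depends on \<open>\<rho>\<close> only. Write \<open>h\<close> for the diameter of the element,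
  \<open>N\<close> for the number of its vertices and \<open>M\<close> for the largest value of \<open>\<bar>v\<bar>\<close> at a vertex.

  The projection is orthogonal for the vertex inner product, so the sum of the squares of its vertex
  values is at most that of \<open>v\<close>, hence at most \<open>N * M\<^sup>2\<close>. An affine function is bounded on the polygon
  by its values at the vertices, and so the squared \<open>L2\<close> norm of the projection is at most
  \<open>N * M\<^sup>2\<close> times the area, which is of order \<open>h\<^sup>2\<close>. It remains to bound \<open>N\<close>, and to show that
  the square of \<open>v\<close> has an integral of order at least \<open>M\<^sup>2 * h\<^sup>2\<close>.

  Both rest on one geometric fact (\<open>half_disc_at_edge\<close>, \<open>mesh_half_disc\<close>): around a point of an edge
  that stays away from the ends of the edge, the closed polygon lies on one side of the edge within a
  distance that is a fixed multiple of \<open>h\<close>, and its boundary there is the edge alone. For any other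
  boundary piece so close to the edge, the star centre would see one point of the boundary through
  another. It follows that the midpoints of the edges are separated by a multiple of \<open>h\<close>, and packing
  discs bounds \<open>N\<close> (\<open>mesh_number_of_vertices\<close>).

  For the lower bound on \<open>v\<close> (\<open>vertex_inverse_estimate\<close>), let \<open>v = M\<close> at a vertex; the other sign is
  symmetric. By the maximum principle \<open>\<bar>v\<bar> \<le> M\<close> on the whole element. On an edge that starts at this
  vertex, \<open>v\<close> is affine with values between \<open>- M\<close> and \<open>M\<close>, hence \<open>v \<ge> M / 2\<close> on its first quarter.
  Comparing \<open>v\<close> with an explicit harmonic quadratic polynomial on the half disc
  (\<open>harmonic_lower_bound_near_edge\<close>) gives \<open>v \<ge> M / 4\<close> on a concentric half disc. That contains a
  disc whose radius is a multiple of \<open>h\<close>, because the star-shaped polygon contains the images of its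
  ball under homotheties with centre on the edge.

  The functions in \<open>V_h\<close> are harmonic only in the sense of distributions, and the maximum principle is
  derived from that directly (\<open>harmonic_maximum_principle\<close>), without regularity theory. Radial test
  functions have Laplacians that are differences of two positive kernels supported in arbitrary rings
  around a point; testing with them compares averages over a large ring with averages over a tiny one.
  Thus a harmonic function that attains its maximum at an interior point equals it nearby.
\<close>

section \<open>Smooth functions of one real variable\<close>

text \<open>
  One-dimensional counterpart of \<open>Ck\<close>: it describes the radial profiles from which test functions
  on the plane are made.
\<close>
primrec Ck_real :: "nat \<Rightarrow> (real \<Rightarrow> real) \<Rightarrow> bool" where
  "Ck_real 0 f \<longleftrightarrow> continuous_on UNIV f"
| "Ck_real (Suc k) f \<longleftrightarrow> (\<exists>f'. (\<forall>x. (f has_real_derivative f' x) (at x)) \<and> Ck_real k f')"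

lemma Ck_real_SucI: "(\<And>x. (f has_real_derivative f' x) (at x)) \<Longrightarrow> Ck_real k f' \<Longrightarrow> Ck_real (Suc k) f"
  by auto

lemma Ck_real_Suc_D: "Ck_real (Suc k) f \<Longrightarrow> Ck_real k f"
proof (induction k arbitrary: f)
  case 0
  then obtain f' where "\<And>x. (f has_real_derivative f' x) (at x)" by auto
  then show ?case by (auto intro: DERIV_isCont continuous_at_imp_continuous_on)
next
  case (Suc k)
  then show ?case by (metis Ck_real.simps(2))
qed

lemma Ck_real_const: "Ck_real k (\<lambda>x. c)"
  by (induction k arbitrary: c) (auto intro!: exI[of _ "\<lambda>x. 0"] derivative_eq_intros)

lemma Ck_real_add: "Ck_real k f \<Longrightarrow> Ck_real k g \<Longrightarrow> Ck_real k (\<lambda>x. f x + g x)"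
proof (induction k arbitrary: f g)
  case (Suc k)
  then obtain f' g' where *: "\<And>x. (f has_real_derivative f' x) (at x)" "Ck_real k f'"
    "\<And>x. (g has_real_derivative g' x) (at x)" "Ck_real k g'" by auto
  show ?case
    using Suc.IH[OF *(2,4)] *(1,3) by (auto intro!: exI[of _ "\<lambda>x. f' x + g' x"] derivative_intros)
qed (auto intro: continuous_intros)

lemma Ck_real_mult: "Ck_real k f \<Longrightarrow> Ck_real k g \<Longrightarrow> Ck_real k (\<lambda>x. f x * g x)"
proof (induction k arbitrary: f g)
  case (Suc k)
  then obtain f' g' where *: "\<And>x. (f has_real_derivative f' x) (at x)" "Ck_real k f'"
    "\<And>x. (g has_real_derivative g' x) (at x)" "Ck_real k g'" by auto
  have "Ck_real k (\<lambda>x. f' x * g x + f x * g' x)"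
    using Suc.prems[THEN Ck_real_Suc_D] * by (intro Ck_real_add Suc.IH) auto
  then show ?case
    by (rule Ck_real_SucI[rotated]) (auto intro!: derivative_eq_intros *)
qed (auto intro: continuous_intros)

lemma Ck_real_affine: "Ck_real k f \<Longrightarrow> Ck_real k (\<lambda>x. f (a * x + b))"
proof (induction k arbitrary: f)
  case 0
  then show ?case
    by (auto intro!: continuous_intros intro: continuous_on_compose2[of UNIV f])
next
  case (Suc k)
  then obtain f' where *: "\<And>x. (f has_real_derivative f' x) (at x)" "Ck_real k f'" by auto
  have "((\<lambda>x. f (a * x + b)) has_real_derivative f' (a * x + b) * a) (at x)" for x
    by (rule DERIV_chain2[OF *(1)]) (auto intro!: derivative_eq_intros)
  then show ?case by (rule Ck_real_SucI) (rule Ck_real_mult[OF Suc.IH[OF *(2)] Ck_real_const])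
qed

text \<open>
  Dividing the classical flat function \<open>exp (- 1 / s)\<close> by powers of \<open>s\<close> gives a family whose linear
  span is closed under differentiation, so that smoothness needs a single computation.
\<close>
definition exp_flat :: "nat \<Rightarrow> real \<Rightarrow> real" where
  "exp_flat n s = (if s \<le> 0 then 0 else exp (- inverse s) / s ^ n)"

lemma exp_flat_DERIV: "(exp_flat n has_real_derivative exp_flat (n + 2) s - real n * exp_flat (Suc n) s) (at s)"
proof -
  consider "s < 0" | "s = 0" | "s > 0" by linarith
  then show ?thesis
  proof cases
    case 1
    have "((\<lambda>s. 0) has_real_derivative 0) (at s)" by simp
    then have "(exp_flat n has_real_derivative 0) (at s)"
      by (rule has_field_derivative_transform_within_open[of _ _ _ "{..<0}"])
        (use 1 in \<open>auto simp: exp_flat_def\<close>)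
    then show ?thesis using 1 by (simp add: exp_flat_def)
  next
    case 2
    have "((\<lambda>h. (exp_flat n h - exp_flat n 0) / h) \<longlongrightarrow> 0) (at 0)"
    proof (rule filterlim_split_at)
      have "eventually (\<lambda>h::real. 0 = (exp_flat n h - exp_flat n 0) / h) (at_left 0)"
        by (auto simp: eventually_at_filter exp_flat_def)
      then show "((\<lambda>h. (exp_flat n h - exp_flat n 0) / h) \<longlongrightarrow> 0) (at_left 0)"
        by (rule Lim_transform_eventually[OF tendsto_const])
    next
      have "((\<lambda>t::real. t ^ Suc n / exp t) \<longlongrightarrow> 0) at_top"
        by (rule tendsto_power_div_exp_0)
      then have "((\<lambda>h::real. inverse h ^ Suc n / exp (inverse h)) \<longlongrightarrow> 0) (at_right 0)"
        by (rule filterlim_compose) (rule filterlim_inverse_at_top_right)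
      moreover have "eventually (\<lambda>h::real. inverse h ^ Suc n / exp (inverse h)
          = (exp_flat n h - exp_flat n 0) / h) (at_right 0)"
        unfolding eventually_at_filter
        by (auto simp: exp_flat_def exp_minus field_simps power_inverse)
      ultimately show "((\<lambda>h. (exp_flat n h - exp_flat n 0) / h) \<longlongrightarrow> 0) (at_right 0)"
        by (rule Lim_transform_eventually)
    qed
    then have "(exp_flat n has_real_derivative 0) (at 0)" by (simp add: DERIV_def)
    then show ?thesis using 2 by (simp add: exp_flat_def)
  next
    case 3
    have "((\<lambda>s. exp (- inverse s) / s ^ n) has_real_derivative
        exp_flat (n + 2) s - real n * exp_flat (Suc n) s) (at s)"
    proof -
      have e: "((\<lambda>s. exp (- inverse s)) has_real_derivative exp (- inverse s) * inverse s ^ 2) (at s)"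
        using 3 by (auto intro!: derivative_eq_intros simp: power2_eq_square)
      have "((\<lambda>s. inverse s ^ n) has_real_derivative
          real n * inverse s ^ (n - 1) * (- (inverse s ^ 2))) (at s)"
        using 3 by (auto intro!: derivative_eq_intros simp: power2_eq_square)
      also have "real n * inverse s ^ (n - 1) * (- (inverse s ^ 2)) = - real n * inverse s ^ Suc n"
        by (cases n) (auto simp: power2_eq_square algebra_simps)
      finally have "((\<lambda>s. exp (- inverse s) * inverse s ^ n) has_real_derivative
          exp (- inverse s) * inverse s ^ 2 * inverse s ^ n
          + - real n * inverse s ^ Suc n * exp (- inverse s)) (at s)"
        by (rule DERIV_mult[OF e])
      then show ?thesis using 3
        by (simp add: exp_flat_def divide_inverse power_inverse algebra_simps power2_eq_square)
    qed
    then show ?thesis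
      by (rule has_field_derivative_transform_within_open[of _ _ _ "{0<..}"])
        (use 3 in \<open>auto simp: exp_flat_def\<close>)
  qed
qed

lemma Ck_real_exp_flat: "Ck_real k (exp_flat n)"
proof (induction k arbitrary: n)
  case 0
  then show ?case by (auto intro!: DERIV_continuous_on exp_flat_DERIV)
next
  case (Suc k)
  have "Ck_real k (\<lambda>s. exp_flat (n + 2) s + (- real n) * exp_flat (Suc n) s)"
    by (intro Ck_real_add Ck_real_mult Ck_real_const Suc)
  then show ?case by (rule Ck_real_SucI[rotated]) (use exp_flat_DERIV[of n] in auto)
qed

lemma smooth_bump:
  fixes \<alpha> \<beta> :: real
  assumes "\<alpha> < \<beta>"
  obtains p where "\<And>k. Ck_real k p" "\<And>s. p s \<ge> 0" "\<And>s. p s > 0 \<longleftrightarrow> \<alpha> < s \<and> s < \<beta>"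
proof
  let ?p = "\<lambda>s. exp_flat 0 (1 * s + (- \<alpha>)) * exp_flat 0 ((-1) * s + \<beta>)"
  show "Ck_real k ?p" for k by (rule Ck_real_mult[OF Ck_real_affine[OF Ck_real_exp_flat] Ck_real_affine[OF Ck_real_exp_flat]])
qed (auto simp: exp_flat_def zero_less_mult_iff)

text \<open>
  Division by the variable turns up in the radial Laplacian, \<open>4 * (s * g' s)'\<close> for the profile
  \<open>g\<close> as a function of the squared distance \<open>s\<close>. It preserves smoothness for functions that vanish
  up to a positive number; the derivative of \<open>Q s / s\<close> has again the form \<open>R s / s\<close>, which
  drives the induction.
\<close>
lemma Ck_real_divide_id:
  assumes "\<alpha> > 0"
  shows "Ck_real k Q \<Longrightarrow> (\<And>s. s < \<alpha> \<Longrightarrow> Q s = 0) \<Longrightarrow> Ck_real k (\<lambda>s. Q s / s)"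
proof (induction k arbitrary: Q)
  case 0
  have "isCont (\<lambda>s. Q s / s) x" for x
  proof (cases "x < \<alpha>")
    case True
    have "isCont (\<lambda>s::real. 0::real) x" by simp
    moreover have "eventually (\<lambda>s. s < \<alpha>) (nhds x)"
      using True by (intro eventually_nhds_in_open[of "{..<\<alpha>}", simplified]) auto
    then have "eventually (\<lambda>s. 0 = Q s / s) (nhds x)"
      by eventually_elim (use 0 in auto)
    ultimately show ?thesis using isCont_cong[of "\<lambda>s. 0" "\<lambda>s. Q s / s" x] by simp
  next
    case False
    then have "x \<noteq> 0" using assms by auto
    then show ?thesis using 0 by (auto intro!: continuous_intros simp: continuous_on_eq_continuous_at)
  qed
  then show ?case by (simp add: continuous_on_eq_continuous_at)
next
  case (Suc k)
  then obtain Q' where Q': "\<And>x. (Q has_real_derivative Q' x) (at x)" "Ck_real k Q'" by auto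
  have z: "Q' s = 0" if "s < \<alpha>" for s
  proof -
    have "((\<lambda>s. 0) has_real_derivative 0) (at s)" by simp
    then have "(Q has_real_derivative 0) (at s)"
      by (rule has_field_derivative_transform_within_open[of _ _ _ "{..<\<alpha>}"])
        (use that Suc in auto)
    with Q'(1) show ?thesis by (rule DERIV_unique)
  qed
  have IH: "Ck_real k (\<lambda>s. Q s / s)" using Suc Ck_real_Suc_D by blast
  have "Ck_real k (\<lambda>s. Q' s + (-1) * (Q s / s))" by (intro Ck_real_add Ck_real_mult Ck_real_const IH Q')
  then have "Ck_real k (\<lambda>s. (Q' s + (-1) * (Q s / s)) / s)"
    using z Suc by (intro Suc.IH) auto
  moreover have "((\<lambda>s. Q s / s) has_real_derivative (Q' x + (-1) * (Q x / x)) / x) (at x)" for x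
  proof (cases "x < \<alpha>")
    case True
    have "((\<lambda>s. 0) has_real_derivative 0) (at x)" by simp
    then have "((\<lambda>s. Q s / s) has_real_derivative 0) (at x)"
      by (rule has_field_derivative_transform_within_open[of _ _ _ "{..<\<alpha>}"])
        (use True Suc in auto)
    then show ?thesis using True z Suc by simp
  next
    case False
    then have "x \<noteq> 0" using assms by auto
    then show ?thesis by (auto intro!: derivative_eq_intros Q' simp: field_simps)
  qed
  ultimately show ?case by (rule Ck_real_SucI[rotated])
qed

lemma Ck_real_antiderivative:
  assumes "\<And>k. Ck_real k f"
  obtains F where "\<And>k. Ck_real k F" "\<And>x. (F has_real_derivative f x) (at x)"
proof -
  have "continuous_on UNIV f" using assms[of 0] by simp
  then have "\<exists>F. \<forall>x::real. -\<infinity> < ereal x \<longrightarrow> ereal x < \<infinity> \<longrightarrow> (F has_vector_derivative f x) (at x)"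
    by (intro einterval_antiderivative) (auto simp: continuous_on_eq_continuous_at)
  then obtain F where F: "\<And>x. (F has_real_derivative f x) (at x)"
    by (auto simp: has_real_derivative_iff_has_vector_derivative)
  then have "Ck_real (Suc k) F" for k using assms by auto
  then have "Ck_real k F" for k using Ck_real_Suc_D by blast
  with F show ?thesis using that by blast
qed

lemma DERIV_zero_constant_on:
  fixes f :: "real \<Rightarrow> real"
  assumes "\<And>x. (f has_real_derivative f' x) (at x)" "\<And>x. x \<in> S \<Longrightarrow> f' x = 0" "is_interval S"
    and "x \<in> S" "y \<in> S"
  shows "f x = f y"
proof -
  have "\<And>x. x \<in> S \<Longrightarrow> (f has_real_derivative 0) (at x within S)"
    using assms(1,2) by (metis has_field_derivative_at_within)
  then show ?thesis
    using has_field_derivative_zero_constant[of S f] assms(3,4,5)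
    by (metis is_interval_convex)
qed

section \<open>Calculus of partial derivatives\<close>

lemma partial_deriv_eq: "(f has_derivative f') (at x) \<Longrightarrow> partial_deriv i f x = f' (axis i 1)"
  unfolding partial_deriv_def using frechet_derivative_at by metis

lemma has_derivative_partial:
  "f differentiable (at x) \<Longrightarrow> (f has_derivative frechet_derivative f (at x)) (at x)"
  using frechet_derivative_works by blast

lemma partial_deriv_add:
  assumes "f differentiable (at x)" "g differentiable (at x)"
  shows "partial_deriv i (\<lambda>x. f x + g x) x = partial_deriv i f x + partial_deriv i g x"
  using partial_deriv_eq[OF has_derivative_add[OF assms[THEN has_derivative_partial]], of i]
  by (simp add: partial_deriv_def)

lemma partial_deriv_mult:
  assumes "f differentiable (at x)" "g differentiable (at x)"
  shows "partial_deriv i (\<lambda>x. f x * g x) x = f x * partial_deriv i g x + partial_deriv i f x * g x"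
  using partial_deriv_eq[OF has_derivative_mult[OF assms[THEN has_derivative_partial]], of i]
  by (simp add: partial_deriv_def)

lemma partial_deriv_const: "partial_deriv i (\<lambda>x. c) = (\<lambda>x. 0)"
  by (rule ext) (simp add: partial_deriv_eq[OF has_derivative_const])

lemma partial_deriv_inner: "partial_deriv i (\<lambda>x. a \<bullet> x) = (\<lambda>x. a $ i)"
proof
  fix x
  have "((\<lambda>x. a \<bullet> x) has_derivative (\<lambda>h. a \<bullet> h)) (at x)" by (auto intro!: derivative_eq_intros)
  from partial_deriv_eq[OF this, of i] show "partial_deriv i (\<lambda>x. a \<bullet> x) x = a $ i"
    by (simp add: inner_axis)
qed

lemma Ck_Suc_D: "Ck (Suc k) f \<Longrightarrow> Ck k f"
proof (induction k arbitrary: f)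
  case 0
  then show ?case
    by (auto intro!: differentiable_imp_continuous_on simp: differentiable_on_def
        intro: differentiable_at_withinI)
next
  case (Suc k)
  then show ?case by (metis Ck.simps(2))
qed

lemma Ck_const: "Ck k (\<lambda>x. c)"
  by (induction k arbitrary: c) (auto simp: partial_deriv_const)

lemma Ck_inner: "Ck k (\<lambda>x. a \<bullet> x)"
  by (cases k) (auto simp: partial_deriv_inner Ck_const intro!: continuous_intros derivative_intros)

lemma Ck_add: "Ck k f \<Longrightarrow> Ck k g \<Longrightarrow> Ck k (\<lambda>x. f x + g x)"
proof (induction k arbitrary: f g)
  case (Suc k)
  then have "partial_deriv i (\<lambda>x. f x + g x) = (\<lambda>x. partial_deriv i f x + partial_deriv i g x)" for i
    by (auto simp: partial_deriv_add)
  with Suc show ?case by (auto intro!: derivative_intros)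
qed (auto intro: continuous_intros)

lemma Ck_mult: "Ck k f \<Longrightarrow> Ck k g \<Longrightarrow> Ck k (\<lambda>x. f x * g x)"
proof (induction k arbitrary: f g)
  case (Suc k)
  have "partial_deriv i (\<lambda>x. f x * g x) = (\<lambda>x. f x * partial_deriv i g x + partial_deriv i f x * g x)" for i
    using Suc.prems by (auto simp: partial_deriv_mult)
  moreover have "Ck k (\<lambda>x. f x * partial_deriv i g x + partial_deriv i f x * g x)" for i
    by (intro Ck_add Suc.IH Ck_Suc_D[OF Suc.prems(1)] Ck_Suc_D[OF Suc.prems(2)]) (use Suc.prems in auto)
  ultimately show ?case using Suc.prems by auto
qed (auto intro: continuous_intros)

lemma Ck_diff: "Ck k f \<Longrightarrow> Ck k g \<Longrightarrow> Ck k (\<lambda>x. f x - g x)"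
  using Ck_add[of k f "\<lambda>x. (-1) * g x"] Ck_mult[OF Ck_const, of k g "-1"] by simp

lemma partial_deriv_diff:
  assumes "f differentiable (at x)" "g differentiable (at x)"
  shows "partial_deriv i (\<lambda>x. f x - g x) x = partial_deriv i f x - partial_deriv i g x"
  using partial_deriv_eq[OF has_derivative_diff[OF assms[THEN has_derivative_partial]], of i]
  by (simp add: partial_deriv_def)

lemma partial_deriv_compose:
  assumes "(g has_real_derivative g') (at (f x))" "f differentiable (at x)"
  shows "partial_deriv i (\<lambda>x. g (f x)) x = g' * partial_deriv i f x"
  using partial_deriv_eq[OF has_derivative_compose[OF has_derivative_partial[OF assms(2)]
      assms(1)[unfolded has_field_derivative_def]], of i]
  by (simp add: partial_deriv_def)

lemma Ck_compose: "Ck_real k g \<Longrightarrow> Ck k f \<Longrightarrow> Ck k (\<lambda>x. g (f x))"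
proof (induction k arbitrary: g)
  case 0
  then show ?case using continuous_on_compose2[of UNIV g UNIV f] by auto
next
  case (Suc k)
  then obtain g' where g': "\<And>x. (g has_real_derivative g' x) (at x)" "Ck_real k g'" by auto
  have d: "f differentiable (at x)" for x using Suc.prems by simp
  have "partial_deriv i (\<lambda>x. g (f x)) = (\<lambda>x. g' (f x) * partial_deriv i f x)" for i
    using partial_deriv_compose[OF g'(1) d] by blast
  moreover have "Ck k (\<lambda>x. g' (f x) * partial_deriv i f x)" for i
    using Suc.prems(2) by (intro Ck_mult[OF Suc.IH[OF g'(2) Ck_Suc_D[OF Suc.prems(2)]]]) simp
  moreover have "(\<lambda>x. g (f x)) differentiable (at x)" for x
    using has_derivative_compose[OF has_derivative_partial[OF d] g'(1)[unfolded has_field_derivative_def]]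
    by (auto simp: differentiable_def)
  ultimately show ?case by auto
qed

lemma partial_deriv_zero_outside:
  assumes "closed K" "\<And>x. x \<notin> K \<Longrightarrow> f x = 0" "x \<notin> K"
  shows "partial_deriv i f x = 0"
proof -
  have "((\<lambda>x. 0) has_derivative (\<lambda>h. 0)) (at x)" by simp
  then have "(f has_derivative (\<lambda>h. 0)) (at x)"
    by (rule has_derivative_transform_within_open[of _ _ _ _ "- K"]) (use assms in auto)
  from partial_deriv_eq[OF this] show ?thesis .
qed

lemma laplacian_zero_outside:
  assumes "closed K" "\<And>x. x \<notin> K \<Longrightarrow> f x = 0" "x \<notin> K"
  shows "laplacian f x = 0"
  unfolding laplacian_def using assms partial_deriv_zero_outside[OF assms(1)] by simp

lemma continuous_laplacian: "Ck 2 f \<Longrightarrow> continuous_on UNIV (laplacian f)"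
  unfolding laplacian_def numeral_2_eq_2 by (intro continuous_on_sum) auto

lemma integrable_continuous_on_compact:
  fixes f :: "real^2 \<Rightarrow> real"
  assumes "compact K" "continuous_on K f" "\<And>x. x \<notin> K \<Longrightarrow> f x = 0"
  shows "integrable lborel f"
proof -
  have "integrable lborel (\<lambda>x. indicator K x *\<^sub>R f x)"
    using borel_integrable_compact[OF assms(1,2)] by simp
  moreover have "(\<lambda>x. indicator K x *\<^sub>R f x) = f"
    using assms(3) by (auto simp: indicator_def fun_eq_iff)
  ultimately show ?thesis by simp
qed

section \<open>Green's identity and harmonicity\<close>

text \<open>
  The difference quotients of \<open>f\<close> in direction \<open>i\<close> have integral zero by translation invariance, and
  they converge boundedly to the partial derivative.
\<close>
lemma integral_partial_deriv_eq_0: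
  fixes f :: "real^2 \<Rightarrow> real"
  assumes f: "Ck 1 f" and K: "compact K" "\<And>x. x \<notin> K \<Longrightarrow> f x = 0"
  shows "integral\<^sup>L lborel (partial_deriv i f) = 0"
proof -
  let ?e = "axis i 1 :: real^2"
  let ?g = "partial_deriv i f"
  define F where "F n x = (f (x + (1 / real (Suc n)) *\<^sub>R ?e) - f x) * real (Suc n)" for n x
  have diff: "f differentiable (at x)" for x using f by simp
  have cf: "continuous_on UNIV f" using f Ck_Suc_D[of 0 f] by simp
  have cg: "continuous_on UNIV ?g" using f by simp
  have cl: "closed K" using K(1) compact_imp_closed by blast
  have g0: "?g x = 0" if "x \<notin> K" for x
    using partial_deriv_zero_outside[OF cl K(2) that] by simp
  have D: "((\<lambda>t. f (x + t *\<^sub>R ?e)) has_real_derivative ?g (x + t *\<^sub>R ?e)) (at t)" for x t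
  proof -
    have "((\<lambda>t. x + t *\<^sub>R ?e) has_derivative (\<lambda>h. h *\<^sub>R ?e)) (at t)"
      by (auto intro!: derivative_eq_intros)
    from has_derivative_compose[OF this has_derivative_partial[OF diff]]
    have "((\<lambda>t. f (x + t *\<^sub>R ?e)) has_derivative
        (\<lambda>h. frechet_derivative f (at (x + t *\<^sub>R ?e)) (h *\<^sub>R ?e))) (at t)" .
    moreover have "frechet_derivative f (at y) (h *\<^sub>R ?e) = ?g y * h" for h y
      using linear_cmul[OF linear_frechet_derivative[OF diff]] by (simp add: partial_deriv_def)
    ultimately show ?thesis by (simp add: has_field_derivative_def)
  qed
  obtain R where R: "K \<subseteq> cball 0 R"
    using compact_imp_bounded[OF K(1)] bounded_subset_ballD[of K 0] ball_subset_cball by blast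
  have "bounded (?g ` K)"
    by (rule compact_imp_bounded[OF compact_continuous_image[OF continuous_on_subset[OF cg] K(1)]]) simp
  then obtain L where L: "\<forall>x\<in>K. \<bar>?g x\<bar> \<le> L" by (auto simp: bounded_iff)
  define L' where "L' = max L 0"
  have L': "\<bar>?g x\<bar> \<le> L'" for x
    using L g0[of x] by (cases "x \<in> K") (auto simp: L'_def)
  have if0: "integrable lborel f"
    by (rule integrable_continuous_on_compact[OF K(1) continuous_on_subset[OF cf] K(2)]) auto
  have bF: "\<bar>F n x\<bar> \<le> L' * indicator (cball 0 (R + 1)) x" for n x
  proof (cases "x \<in> cball 0 (R + 1)")
    case True
    obtain z where "f (x + (1 / real (Suc n)) *\<^sub>R ?e) - f (x + 0 *\<^sub>R ?e)
        = (1 / real (Suc n) - 0) * ?g (x + z *\<^sub>R ?e)"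
      using MVT2[of 0 "1 / real (Suc n)" "\<lambda>t. f (x + t *\<^sub>R ?e)" "\<lambda>t. ?g (x + t *\<^sub>R ?e)"] D by auto
    then have "F n x = ?g (x + z *\<^sub>R ?e)" by (simp add: F_def)
    with L' True show ?thesis by simp
  next
    case False
    have "norm x \<le> norm (x + (1 / real (Suc n)) *\<^sub>R ?e) + norm ((1 / real (Suc n)) *\<^sub>R ?e)"
      using norm_triangle_ineq4[of "x + (1 / real (Suc n)) *\<^sub>R ?e" "(1 / real (Suc n)) *\<^sub>R ?e"] by simp
    moreover have "norm ((1 / real (Suc n)) *\<^sub>R ?e) \<le> 1" by (simp add: norm_axis_1)
    ultimately have "R < norm (x + (1 / real (Suc n)) *\<^sub>R ?e)" "R < norm x"
      using False by (simp_all only: mem_cball_0)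
    then have "x + (1 / real (Suc n)) *\<^sub>R ?e \<notin> cball 0 R" "x \<notin> cball 0 R"
      by (simp_all only: mem_cball_0 not_le)
    then have "f x = 0" "f (x + (1 / real (Suc n)) *\<^sub>R ?e) = 0" using R K(2) by blast+
    with False show ?thesis by (simp add: F_def)
  qed
  have lim: "(\<lambda>n. F n x) \<longlonglongrightarrow> ?g x" for x
  proof -
    have "((\<lambda>h. (f (x + h *\<^sub>R ?e) - f x) / h) \<longlongrightarrow> ?g x) (at 0)"
      using D[of x 0] by (simp add: DERIV_def)
    moreover have "filterlim (\<lambda>n. 1 / real (Suc n)) (at 0) sequentially"
      unfolding filterlim_at using LIMSEQ_Suc[OF lim_1_over_n] by auto
    ultimately have "(\<lambda>n. (f (x + (1 / real (Suc n)) *\<^sub>R ?e) - f x) / (1 / real (Suc n))) \<longlonglongrightarrow> ?g x"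
      by (rule filterlim_compose)
    then show ?thesis by (simp add: F_def)
  qed
  have tr: "integrable lborel (\<lambda>x. f (x + c))"
    "integral\<^sup>L lborel (\<lambda>x. f (x + c)) = integral\<^sup>L lborel f" for c
  proof -
    have "f \<in> borel_measurable borel" using cf by (rule borel_measurable_continuous_onI)
    then show "integrable lborel (\<lambda>x. f (x + c))"
        "integral\<^sup>L lborel (\<lambda>x. f (x + c)) = integral\<^sup>L lborel f"
      using if0 integrable_distr_eq[of "(+) c" lborel borel f] integral_distr[of "(+) c" lborel borel f]
      by (simp_all add: lborel_distr_plus add.commute)
  qed
  have "(\<lambda>n. integral\<^sup>L lborel (F n)) \<longlonglongrightarrow> integral\<^sup>L lborel ?g"
  proof (rule integral_dominated_convergence)
    show "integrable lborel (\<lambda>x. L' * indicator (cball 0 (R + 1)) x :: real)"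
      by (intro integrable_mult_right integrable_real_indicator) (auto simp: emeasure_bounded_finite[simplified])
    show "?g \<in> borel_measurable lborel" using borel_measurable_continuous_onI[OF cg] by simp
    show "F n \<in> borel_measurable lborel" for n
      unfolding F_def using tr(1) if0 by (auto dest!: borel_measurable_integrable)
  qed (use bF lim in auto)
  moreover have "integral\<^sup>L lborel (F n) = 0" for n
    unfolding F_def using tr if0 by simp
  ultimately show ?thesis by (simp add: LIMSEQ_const_iff)
qed

lemma test_functionE:
  assumes "test_function D \<phi>"
  obtains K where "compact K" "K \<subseteq> D" "\<And>x. x \<notin> K \<Longrightarrow> \<phi> x = 0" "\<And>k. Ck k \<phi>"
proof
  show "x \<notin> closure {x. \<phi> x \<noteq> 0} \<Longrightarrow> \<phi> x = 0" for x
    using closure_subset[of "{x. \<phi> x \<noteq> 0}"] by blast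
qed (use assms in \<open>auto simp: test_function_def\<close>)

lemma test_functionI:
  assumes "\<And>k. Ck k \<phi>" "compact K" "K \<subseteq> D" "\<And>x. x \<notin> K \<Longrightarrow> \<phi> x = 0"
  shows "test_function D \<phi>"
proof -
  have "closure {x. \<phi> x \<noteq> 0} \<subseteq> K"
    using assms(2,4) by (intro closure_minimal) (auto intro: compact_imp_closed)
  then show ?thesis using assms
    by (auto simp: test_function_def compact_eq_bounded_closed intro: bounded_subset)
qed

text \<open>
  This makes harmonicity hereditary for subsets: the domain of integration is irrelevant as long as
  it contains the support of the test function.
\<close>
lemma set_integral_laplacian_cong:
  assumes "test_function D \<phi>" "D \<subseteq> E"
  shows "(LINT x:E|lebesgue. v x * laplacian \<phi> x) = (LINT x:D|lebesgue. v x * laplacian \<phi> x)"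
proof -
  obtain K where "compact K" "K \<subseteq> D" "\<And>x. x \<notin> K \<Longrightarrow> \<phi> x = 0" "\<And>k. Ck k \<phi>"
    by (rule test_functionE[OF assms(1)]) (rule that)
  then have "laplacian \<phi> x = 0" if "x \<notin> D" for x
    using laplacian_zero_outside[of K \<phi> x] that compact_imp_closed by blast
  then have "indicator E x *\<^sub>R (v x * laplacian \<phi> x) = indicator D x *\<^sub>R (v x * laplacian \<phi> x)" for x
    using assms(2) by (auto simp: indicator_def)
  then show ?thesis unfolding set_lebesgue_integral_def by (rule Bochner_Integration.integral_cong[OF refl])
qed

lemma harmonic_in_subset:
  assumes "harmonic_in E v" "D \<subseteq> E"
  shows "harmonic_in D v"
proof -
  have "test_function E \<phi>" if "test_function D \<phi>" for \<phi>
    using that assms(2) by (auto simp: test_function_def)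
  then show ?thesis
    using assms set_integral_laplacian_cong[OF _ assms(2)] unfolding harmonic_in_def by metis
qed

lemma set_integrable_laplacian:
  assumes "test_function D \<phi>" "continuous_on D v"
  shows "integrable lborel (\<lambda>x. indicator D x * (v x * laplacian \<phi> x))"
    and "integrable lebesgue (\<lambda>x. indicator D x * (v x * laplacian \<phi> x))"
proof -
  obtain K where K: "compact K" "K \<subseteq> D" "\<And>x. x \<notin> K \<Longrightarrow> \<phi> x = 0" "\<And>k. Ck k \<phi>"
    by (rule test_functionE[OF assms(1)]) (rule that)
  have l: "laplacian \<phi> x = 0" if "x \<notin> K" for x
    using laplacian_zero_outside[of K \<phi> x] that K compact_imp_closed by blast
  have "continuous_on K (\<lambda>x. v x * laplacian \<phi> x)"
    using continuous_laplacian[OF K(4)] K(2) assms(2)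
    by (auto intro!: continuous_intros intro: continuous_on_subset)
  then have "continuous_on K (\<lambda>x. indicator D x * (v x * laplacian \<phi> x))"
    by (rule continuous_on_eq) (use K(2) in auto)
  then show *: "integrable lborel (\<lambda>x. indicator D x * (v x * laplacian \<phi> x))"
    by (rule integrable_continuous_on_compact[OF K(1)]) (use l in auto)
  show "integrable lebesgue (\<lambda>x. indicator D x * (v x * laplacian \<phi> x))"
    using integrable_completion[OF borel_measurable_integrable[OF *]] * by simp
qed

lemma harmonic_in_diff:
  assumes "harmonic_in D u" "harmonic_in D v" "continuous_on D u" "continuous_on D v"
  shows "harmonic_in D (\<lambda>x. u x - v x)"
  unfolding harmonic_in_def
proof (intro allI impI)
  fix \<phi> assume \<phi>: "test_function D \<phi>"
  have "(LINT x:D|lebesgue. (u x - v x) * laplacian \<phi> x)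
      = (LINT x:D|lebesgue. u x * laplacian \<phi> x) - (LINT x:D|lebesgue. v x * laplacian \<phi> x)"
    unfolding left_diff_distrib
    by (rule set_integral_diff) (use set_integrable_laplacian[OF \<phi>] assms in \<open>simp_all add: set_integrable_def\<close>)
  then show "(LINT x:D|lebesgue. (u x - v x) * laplacian \<phi> x) = 0"
    using assms(1,2) \<phi> by (simp add: harmonic_in_def)
qed

lemma harmonic_in_uminus: "harmonic_in D v \<Longrightarrow> harmonic_in D (\<lambda>x. - v x)"
  by (simp add: harmonic_in_def set_lebesgue_integral_def)

lemma set_integral_lborel:
  fixes f :: "real^2 \<Rightarrow> real"
  assumes "integrable lborel (\<lambda>x. indicator D x * f x)"
  shows "(LINT x:D|lebesgue. f x) = (LINT x|lborel. indicator D x * f x)"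
  using integral_completion[OF borel_measurable_integrable[OF assms]]
  by (simp add: set_lebesgue_integral_def)

text \<open>
  Green's second identity: \<open>H * laplacian \<phi> - laplacian H * \<phi>\<close> is the sum of the partial derivatives
  of the compactly supported fields \<open>H * \<partial>\<^sub>i \<phi> - \<partial>\<^sub>i H * \<phi>\<close>. It supplies the harmonicity of
  constants and of the barrier polynomial.
\<close>
lemma harmonic_in_smooth:
  assumes H: "Ck 2 H" and lap: "\<And>x. laplacian H x = 0"
  shows "harmonic_in D H"
  unfolding harmonic_in_def
proof (intro allI impI)
  fix \<phi> assume \<phi>: "test_function D \<phi>"
  obtain K where K: "compact K" "K \<subseteq> D" "\<And>x. x \<notin> K \<Longrightarrow> \<phi> x = 0" "\<And>k. Ck k \<phi>"
    by (rule test_functionE[OF \<phi>]) (rule that)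
  have cl: "closed K" using K(1) compact_imp_closed by blast
  have l0: "laplacian \<phi> x = 0" if "x \<notin> D" for x
    using laplacian_zero_outside[of K \<phi> x] that K cl by blast
  have H1: "Ck 1 H" "\<And>i. Ck 1 (partial_deriv i H)"
    and \<phi>1: "Ck 1 \<phi>" "\<And>i. Ck 1 (partial_deriv i \<phi>)"
    using Ck_Suc_D[of 1 H] H K(4)[of 1] K(4)[of 2] by (auto simp: numeral_2_eq_2)
  let ?\<psi> = "\<lambda>i x. H x * partial_deriv i \<phi> x - partial_deriv i H x * \<phi> x"
  have C: "Ck 1 (?\<psi> i)" for i
    by (intro Ck_diff Ck_mult H1 \<phi>1)
  have p0: "partial_deriv i \<phi> x = 0" if "x \<notin> K" for x i
    using partial_deriv_zero_outside[OF cl K(3) that] by simp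
  then have \<psi>0: "?\<psi> i x = 0" if "x \<notin> K" for x i
    using that K(3) by simp
  have int: "integral\<^sup>L lborel (partial_deriv i (?\<psi> i)) = 0" for i
    by (rule integral_partial_deriv_eq_0[OF C K(1) \<psi>0])
  have itg: "integrable lborel (partial_deriv i (?\<psi> i))" for i
  proof (rule integrable_continuous_on_compact[OF K(1)])
    show "continuous_on K (partial_deriv i (?\<psi> i))"
      using C[of i] by (auto intro: continuous_on_subset)
    show "partial_deriv i (?\<psi> i) x = 0" if "x \<notin> K" for x
      using partial_deriv_zero_outside[OF cl \<psi>0 that] by simp
  qed
  have P: "partial_deriv i (?\<psi> i) x = H x * partial_deriv i (partial_deriv i \<phi>) x
      - partial_deriv i (partial_deriv i H) x * \<phi> x" for i x
  proof -
    have d: "H differentiable (at x)" "\<phi> differentiable (at x)"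
      "partial_deriv i H differentiable (at x)" "partial_deriv i \<phi> differentiable (at x)"
      using H1 \<phi>1 by auto
    show ?thesis
      by (subst partial_deriv_diff) (auto intro!: derivative_intros simp: d partial_deriv_mult)
  qed
  have "(\<Sum>i\<in>UNIV. partial_deriv i (?\<psi> i) x) = H x * laplacian \<phi> x" for x
    using lap[of x] by (simp add: P sum_subtractf laplacian_def flip: sum_distrib_left sum_distrib_right)
  moreover have "(LINT x|lborel. (\<Sum>i\<in>UNIV. partial_deriv i (?\<psi> i) x)) = 0"
    using itg int by (simp add: Bochner_Integration.integral_sum)
  moreover have "(\<lambda>x. indicator D x * (H x * laplacian \<phi> x)) = (\<lambda>x. H x * laplacian \<phi> x)"
    using l0 by (auto simp: indicator_def fun_eq_iff)
  moreover have "continuous_on D H"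
    using H1(1) Ck_Suc_D[of 0 H] by (auto intro: continuous_on_subset)
  ultimately show "(LINT x:D|lebesgue. H x * laplacian \<phi> x) = 0"
    using set_integral_lborel[OF set_integrable_laplacian(1)[OF \<phi>]] by simp
qed

section \<open>The maximum principle for distributionally harmonic functions\<close>

text \<open>
  Bumps are normalised through their primitive \<open>Q\<close>, which rises from 0 to 1: the difference of two
  such primitives has compact support, which is what the radial test functions require.
\<close>
lemma unit_bump:
  fixes \<alpha> \<beta> :: real
  assumes "\<alpha> < \<beta>"
  obtains p Q where "\<And>k. Ck_real k p" "\<And>k. Ck_real k Q" "\<And>s. (Q has_real_derivative p s) (at s)"
    "\<And>s. p s \<ge> 0" "\<And>s. p s > 0 \<longleftrightarrow> \<alpha> < s \<and> s < \<beta>"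
    "\<And>s. s \<le> \<alpha> \<Longrightarrow> Q s = 0" "\<And>s. s \<ge> \<beta> \<Longrightarrow> Q s = 1"
proof -
  obtain p where p: "\<And>k. Ck_real k p" "\<And>s. p s \<ge> 0" "\<And>s. p s > 0 \<longleftrightarrow> \<alpha> < s \<and> s < \<beta>"
    using smooth_bump[OF assms] by metis
  obtain F where F: "\<And>k. Ck_real k F" "\<And>x. (F has_real_derivative p x) (at x)"
    using Ck_real_antiderivative[OF p(1)] by metis
  have p0: "p s = 0" if "s \<le> \<alpha> \<or> s \<ge> \<beta>" for s
    using p(2)[of s] p(3)[of s] that by linarith
  define c where "c = F \<beta> - F \<alpha>"
  obtain z where "\<alpha> < z" "z < \<beta>" "F \<beta> - F \<alpha> = (\<beta> - \<alpha>) * p z"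
    using MVT2[OF assms, of F p] F(2) by blast
  then have c: "c > 0" using p(3)[of z] assms by (simp add: c_def)
  let ?p = "\<lambda>s. (1 / c) * p s" and ?Q = "\<lambda>s. (1 / c) * (F s + (- F \<alpha>))"
  show thesis
  proof
    show "Ck_real k ?p" "Ck_real k ?Q" for k
      by (rule Ck_real_mult[OF Ck_real_const p(1)], rule Ck_real_mult[OF Ck_real_const Ck_real_add[OF F(1) Ck_real_const]])
    show "(?Q has_real_derivative ?p s) (at s)" for s
      by (auto intro!: derivative_eq_intros F(2) simp: c[THEN less_imp_neq, symmetric])
    show "?p s \<ge> 0" for s using p(2) c by simp
    show "?p s > 0 \<longleftrightarrow> \<alpha> < s \<and> s < \<beta>" for s
      using p(3)[of s] c by (simp add: zero_less_divide_iff zero_less_mult_iff)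
    show "?Q s = 0" if "s \<le> \<alpha>" for s
    proof -
      have "F s = F \<alpha>"
        by (rule DERIV_zero_constant_on[OF F(2), of "{..\<alpha>}"]) (use p0 that in \<open>auto simp: is_interval_ic\<close>)
      then show ?thesis by simp
    qed
    show "?Q s = 1" if "s \<ge> \<beta>" for s
    proof -
      have "F s = F \<beta>"
        by (rule DERIV_zero_constant_on[OF F(2), of "{\<beta>..}"]) (use p0 that in \<open>auto simp: is_interval_ci\<close>)
      then show ?thesis using c by (simp add: c_def)
    qed
  qed
qed

text \<open>
  For a radial function \<open>G (s)\<close> of \<open>s = (dist x0 x)\<^sup>2\<close> in the plane, the Laplacian is
  \<open>4 * (s * G' s)'\<close>. Hence \<open>G' s = Q s / s\<close> produces the Laplacian \<open>4 * Q' s\<close>, and the vanishing of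
  \<open>Q\<close> near 0 and beyond \<open>b\<close> makes \<open>G\<close> constant near the centre and compactly supported.
\<close>
lemma radial_test_function:
  fixes x0 :: "real^2"
  assumes "0 < a"
    and P: "\<And>k. Ck_real k P" and Q: "\<And>k. Ck_real k Q" "\<And>s. (Q has_real_derivative P s) (at s)"
    and Q0: "\<And>s. s < a \<Longrightarrow> Q s = 0" "\<And>s. s \<ge> b \<Longrightarrow> Q s = 0"
    and D: "{x. (dist x0 x)\<^sup>2 \<le> b} \<subseteq> D"
  obtains \<phi> where "test_function D \<phi>" "\<And>x. laplacian \<phi> x = 4 * P ((dist x0 x)\<^sup>2)"
proof -
  define B where "B s = Q s / s" for s
  have B: "Ck_real k B" for k unfolding B_def by (rule Ck_real_divide_id[OF assms(1) Q(1) Q0(1)])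
  obtain F where F: "\<And>k. Ck_real k F" "\<And>s. (F has_real_derivative B s) (at s)"
    using Ck_real_antiderivative[OF B] by metis
  obtain B' where B': "\<And>s. (B has_real_derivative B' s) (at s)" using B[of 1] by auto
  \<comment> \<open>\<open>s * B s = Q s\<close> holds at \<open>s = 0\<close> as well, where both sides vanish.\<close>
  have eq: "s * B' s + B s = P s" for s
  proof -
    have "((\<lambda>s. s * B s) has_real_derivative s * B' s + B s) (at s)"
      by (auto intro!: derivative_eq_intros B')
    moreover have "(\<lambda>s. s * B s) = Q" using Q0(1)[of 0] assms(1) by (auto simp: B_def)
    ultimately show ?thesis using Q(2) DERIV_unique by metis
  qed
  define G where "G s = F s + (- F b)" for s
  have G: "Ck_real k G" for k unfolding G_def by (rule Ck_real_add[OF F(1) Ck_real_const])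
  have G': "(G has_real_derivative B s) (at s)" for s
    unfolding G_def by (auto intro!: derivative_eq_intros F(2))
  have G0: "G s = 0" if "s \<ge> b" for s
  proof -
    have "F s = F b"
      by (rule DERIV_zero_constant_on[OF F(2), of "{b..}"]) (use that Q0 in \<open>auto simp: B_def is_interval_ci\<close>)
    then show ?thesis by (simp add: G_def)
  qed
  define \<sigma> where "\<sigma> x = (dist x0 x)\<^sup>2" for x
  have \<sigma>: "\<sigma> = (\<lambda>x. (\<Sum>j\<in>UNIV. (axis j 1 \<bullet> x - x0 $ j) * (axis j 1 \<bullet> x - x0 $ j)))"
    unfolding \<sigma>_def dist_norm power2_norm_eq_inner inner_axis'
    by (simp add: inner_vec_def fun_eq_iff algebra_simps)
  have Ck\<sigma>: "Ck k \<sigma>" for k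
    unfolding \<sigma> sum_2 by (intro Ck_add Ck_mult Ck_diff Ck_inner Ck_const)
  have d\<sigma>: "partial_deriv i \<sigma> = (\<lambda>x. 2 * (x $ i - x0 $ i))" for i
  proof
    fix x
    have "(\<sigma> has_derivative (\<lambda>h. 2 * ((x - x0) \<bullet> h))) (at x)"
      unfolding \<sigma>_def dist_norm power2_norm_eq_inner
      by (auto intro!: derivative_eq_intros simp: inner_commute algebra_simps inner_diff_left)
    from partial_deriv_eq[OF this] show "partial_deriv i \<sigma> x = 2 * (x $ i - x0 $ i)"
      by (simp add: inner_axis)
  qed
  have dd: "partial_deriv i (\<lambda>x. 2 * (x $ i - x0 $ i)) x = 2" for i and x :: "real^2"
  proof -
    have "((\<lambda>x. 2 * (axis i 1 \<bullet> x - x0 $ i)) has_derivative (\<lambda>h. 2 * (axis i 1 \<bullet> h))) (at x)"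
      by (auto intro!: derivative_eq_intros)
    from partial_deriv_eq[OF this, of i] show ?thesis by (simp add: inner_axis' inner_axis)
  qed
  let ?\<phi> = "\<lambda>x. G (\<sigma> x)"
  have d1: "partial_deriv i ?\<phi> = (\<lambda>x. B (\<sigma> x) * (2 * (x $ i - x0 $ i)))" for i
    using partial_deriv_compose[OF G', of \<sigma>] Ck\<sigma>[of 1] d\<sigma> by (simp add: fun_eq_iff)
  have d2: "partial_deriv i (partial_deriv i ?\<phi>) x = B' (\<sigma> x) * 4 * (x $ i - x0 $ i)\<^sup>2 + 2 * B (\<sigma> x)" for i x
  proof -
    have "Ck 1 (\<lambda>x. B (\<sigma> x))" "Ck 1 (\<lambda>x. 2 * (axis i 1 \<bullet> x - x0 $ i))"
      by (rule Ck_compose[OF B Ck\<sigma>], intro Ck_mult Ck_diff Ck_inner Ck_const)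
    then have "partial_deriv i (partial_deriv i ?\<phi>) x
        = B (\<sigma> x) * partial_deriv i (\<lambda>x. 2 * (x $ i - x0 $ i)) x
          + partial_deriv i (\<lambda>x. B (\<sigma> x)) x * (2 * (x $ i - x0 $ i))"
      unfolding d1 by (intro partial_deriv_mult) (simp_all add: inner_axis')
    also have "partial_deriv i (\<lambda>x. B (\<sigma> x)) x = B' (\<sigma> x) * partial_deriv i \<sigma> x"
      using partial_deriv_compose[OF B', of \<sigma>] Ck\<sigma>[of 1] by simp
    finally show ?thesis unfolding dd d\<sigma> by (simp add: power2_eq_square algebra_simps)
  qed
  have lap: "laplacian ?\<phi> x = 4 * P (\<sigma> x)" for x
  proof -
    have "laplacian ?\<phi> x = 4 * (B' (\<sigma> x) * (\<Sum>i\<in>UNIV. (x $ i - x0 $ i)\<^sup>2) + B (\<sigma> x))"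
      unfolding laplacian_def d2 sum_2 by (simp add: algebra_simps)
    also have "(\<Sum>i\<in>UNIV. (x $ i - x0 $ i)\<^sup>2) = \<sigma> x"
      unfolding \<sigma> by (simp add: inner_axis' power2_eq_square)
    finally show ?thesis using eq[of "\<sigma> x"] by (simp add: mult.commute)
  qed
  have "test_function D ?\<phi>"
  proof (rule test_functionI)
    show "Ck k ?\<phi>" for k by (rule Ck_compose[OF G Ck\<sigma>])
    have "bounded {x. \<sigma> x \<le> b}"
    proof (rule bounded_subset[OF bounded_cball])
      show "{x. \<sigma> x \<le> b} \<subseteq> cball x0 (sqrt b)"
        unfolding \<sigma>_def using real_le_rsqrt by auto
    qed
    moreover have "closed {x. \<sigma> x \<le> b}"
      using Ck\<sigma>[of 0] by (intro closed_Collect_le) auto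
    ultimately show "compact {x. \<sigma> x \<le> b}" by (simp add: compact_eq_bounded_closed)
    show "{x. \<sigma> x \<le> b} \<subseteq> D" using D by (simp add: \<sigma>_def)
    show "?\<phi> x = 0" if "x \<notin> {x. \<sigma> x \<le> b}" for x using that G0 by simp
  qed
  then show thesis using that[of ?\<phi>] lap by (simp add: \<sigma>_def)
qed

text \<open>
  A form of the mean value property: the averages of a harmonic function against two normalised
  radial kernels agree, since the difference of the kernels is the Laplacian of a test function.
  The kernels vanish near the centre, where \<open>Q s / s\<close> might fail to be smooth.
\<close>
lemma harmonic_ring_averages:
  fixes x0 :: "real^2"
  assumes w: "harmonic_in D w" "continuous_on D w"
    and a: "0 < a" and D: "{x. (dist x0 x)\<^sup>2 \<le> b} \<subseteq> D"
    and 1: "\<And>k. Ck_real k p1" "\<And>k. Ck_real k Q1" "\<And>s. (Q1 has_real_derivative p1 s) (at s)"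
      "\<And>s. s \<le> a \<Longrightarrow> Q1 s = 0" "\<And>s. s \<ge> b \<Longrightarrow> Q1 s = 1" "\<And>s. s > b \<Longrightarrow> p1 s = 0"
    and 2: "\<And>k. Ck_real k p2" "\<And>k. Ck_real k Q2" "\<And>s. (Q2 has_real_derivative p2 s) (at s)"
      "\<And>s. s \<le> a \<Longrightarrow> Q2 s = 0" "\<And>s. s \<ge> b \<Longrightarrow> Q2 s = 1" "\<And>s. s > b \<Longrightarrow> p2 s = 0"
  shows "(LINT x|lborel. indicator D x * (w x * p1 ((dist x0 x)\<^sup>2)))
      = (LINT x|lborel. indicator D x * (w x * p2 ((dist x0 x)\<^sup>2)))"
    and "integrable lborel (\<lambda>x. indicator D x * (w x * p1 ((dist x0 x)\<^sup>2)))"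
    and "integrable lborel (\<lambda>x. indicator D x * (w x * p2 ((dist x0 x)\<^sup>2)))"
proof -
  have I: "integrable lborel (\<lambda>x. indicator D x * (w x * p ((dist x0 x)\<^sup>2)))"
    if p: "\<And>k. Ck_real k p" "\<And>s. s > b \<Longrightarrow> p s = 0" for p
  proof (rule integrable_continuous_on_compact)
    have "{x. (dist x0 x)\<^sup>2 \<le> b} \<subseteq> cball x0 (sqrt b)" using real_le_rsqrt by auto
    moreover have "closed {x. (dist x0 x)\<^sup>2 \<le> b}" by (intro closed_Collect_le continuous_intros)
    ultimately show "compact {x. (dist x0 x)\<^sup>2 \<le> b}"
      by (simp add: compact_eq_bounded_closed bounded_subset[OF bounded_cball])
    have "continuous_on UNIV (\<lambda>x. p ((dist x0 x)\<^sup>2))"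
      by (rule continuous_on_compose2[of UNIV p UNIV "\<lambda>x. (dist x0 x)\<^sup>2"])
        (use p(1)[of 0] in \<open>auto intro!: continuous_intros\<close>)
    then have "continuous_on {x. (dist x0 x)\<^sup>2 \<le> b} (\<lambda>x. w x * p ((dist x0 x)\<^sup>2))"
      using w(2) D by (intro continuous_on_mult) (auto intro: continuous_on_subset)
    then show "continuous_on {x. (dist x0 x)\<^sup>2 \<le> b} (\<lambda>x. indicator D x * (w x * p ((dist x0 x)\<^sup>2)))"
      by (rule continuous_on_eq) (use D in auto)
    show "indicator D x * (w x * p ((dist x0 x)\<^sup>2)) = 0" if "x \<notin> {x. (dist x0 x)\<^sup>2 \<le> b}" for x
      using that p(2) by simp
  qed
  show I1: "integrable lborel (\<lambda>x. indicator D x * (w x * p1 ((dist x0 x)\<^sup>2)))"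
    and I2: "integrable lborel (\<lambda>x. indicator D x * (w x * p2 ((dist x0 x)\<^sup>2)))"
    by (rule I[OF 1(1,6)], assumption) (rule I[OF 2(1,6)])
  have DP: "Ck_real k (\<lambda>s. p1 s + (-1) * p2 s)" "Ck_real k (\<lambda>s. Q1 s + (-1) * Q2 s)" for k
    by (rule Ck_real_add[OF 1(1) Ck_real_mult[OF Ck_real_const 2(1)]], rule Ck_real_add[OF 1(2) Ck_real_mult[OF Ck_real_const 2(2)]])
  have dQ: "((\<lambda>s. Q1 s + (-1) * Q2 s) has_real_derivative p1 s + (-1) * p2 s) (at s)" for s
    by (auto intro!: derivative_eq_intros 1(3) 2(3))
  obtain \<phi> where \<phi>: "test_function D \<phi>"
    "\<And>x. laplacian \<phi> x = 4 * (p1 ((dist x0 x)\<^sup>2) + (-1) * p2 ((dist x0 x)\<^sup>2))"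
    by (rule radial_test_function[OF a DP dQ _ _ D]) (use 1(4,5) 2(4,5) in auto)
  have "(LINT x|lborel. indicator D x * (w x * laplacian \<phi> x)) = 0"
    using w(1) \<phi>(1) set_integral_lborel[OF set_integrable_laplacian(1)[OF \<phi>(1) w(2)]]
    by (simp add: harmonic_in_def)
  also have "(\<lambda>x. indicator D x * (w x * laplacian \<phi> x))
      = (\<lambda>x. 4 * (indicator D x * (w x * p1 ((dist x0 x)\<^sup>2)) - indicator D x * (w x * p2 ((dist x0 x)\<^sup>2))))"
    by (simp add: \<phi>(2) fun_eq_iff algebra_simps)
  finally show "(LINT x|lborel. indicator D x * (w x * p1 ((dist x0 x)\<^sup>2)))
      = (LINT x|lborel. indicator D x * (w x * p2 ((dist x0 x)\<^sup>2)))"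
    using I1 I2 by simp
qed

lemma harmonic_const: "harmonic_in D (\<lambda>x. c)"
  by (rule harmonic_in_smooth) (simp_all add: Ck_const laplacian_def partial_deriv_const)

text \<open>
  Fix a ring through \<open>x1\<close>. The average \<open>J\<close> of \<open>w\<close> over it equals the average over an arbitrarily
  small ring around \<open>x0\<close>, where \<open>w\<close> is arbitrarily small by continuity. Both kernels have the same
  total mass, by the same comparison applied to the constant 1, and thus \<open>J = 0\<close>.
\<close>
lemma harmonic_nonneg_zero_near:
  fixes x0 :: "real^2"
  assumes w: "harmonic_in D w" "continuous_on D w" "\<And>x. x \<in> D \<Longrightarrow> w x \<ge> 0" "open D"
    and x0: "w x0 = 0" "cball x0 \<rho> \<subseteq> D" and x1: "x1 \<in> ball x0 \<rho>"
  shows "w x1 = 0"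
proof (rule ccontr)
  assume "w x1 \<noteq> 0"
  have \<rho>: "\<rho> > 0" using x1 by (metis dist_pos_lt dist_self less_trans mem_ball)
  have x1D: "x1 \<in> D" "x0 \<in> D" using x0 x1 \<rho> by auto
  with \<open>w x1 \<noteq> 0\<close> w(3) have w1: "w x1 > 0" by force
  then have ne: "x1 \<noteq> x0" using x0 by auto
  let ?s = "\<lambda>x. (dist x0 x)\<^sup>2"
  define \<alpha> where "\<alpha> = ?s x1 / 2"
  have \<alpha>: "0 < \<alpha>" "\<alpha> < ?s x1" using ne by (auto simp: \<alpha>_def)
  have s\<rho>: "?s x1 < \<rho>\<^sup>2" using x1 by (auto intro!: power_strict_mono)
  have sub: "{x. (dist x0 x)\<^sup>2 \<le> \<rho>\<^sup>2} \<subseteq> D"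
    using x0(2) \<rho> by (auto simp: abs_le_square_iff[symmetric])
  obtain p1 Q1 where 1: "\<And>k. Ck_real k p1" "\<And>k. Ck_real k Q1" "\<And>s. (Q1 has_real_derivative p1 s) (at s)"
    "\<And>s. p1 s \<ge> 0" "\<And>s. p1 s > 0 \<longleftrightarrow> \<alpha> < s \<and> s < \<rho>\<^sup>2"
    "\<And>s. s \<le> \<alpha> \<Longrightarrow> Q1 s = 0" "\<And>s. s \<ge> \<rho>\<^sup>2 \<Longrightarrow> Q1 s = 1"
    by (rule unit_bump[OF less_trans[OF \<alpha>(2) s\<rho>]]) (rule that)
  have p10: "p1 s = 0" if "s > \<rho>\<^sup>2" for s using 1(4,5)[of s] that by linarith
  let ?k1 = "\<lambda>x. indicator D x * (w x * p1 (?s x))"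
  define J where "J = (LINT x|lborel. ?k1 x)"
  define m where "m = (LINT x|lborel. indicator D x * (1 * p1 (?s x)))"
  have m0: "m \<ge> 0" unfolding m_def by (rule integral_nonneg_AE) (use 1(4) in auto)
  have Ik1: "integrable lborel ?k1"
    by (rule harmonic_ring_averages(2)[OF w(1,2) \<alpha>(1) sub 1(1-3,6,7) p10 1(1-3,6,7) p10]) auto
  have J0: "J > 0"
  proof -
    have "continuous_on UNIV (\<lambda>x. p1 (?s x))"
      by (rule continuous_on_compose2[of UNIV p1 UNIV ?s])
        (use 1(1)[of 0] in \<open>auto intro!: continuous_intros\<close>)
    then have "continuous_on D (\<lambda>x. w x * p1 (?s x))"
      using w(2) by (intro continuous_on_mult) (auto intro: continuous_on_subset)
    then have op: "open ((\<lambda>x. w x * p1 (?s x)) -` {w x1 * p1 (?s x1) / 2<..} \<inter> D)" (is "open ?U")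
      using w(4) by (auto simp: continuous_on_open_vimage)
    have pos: "w x1 * p1 (?s x1) > 0" using w1 1(5) \<alpha> s\<rho> by simp
    have "x1 \<in> ?U" using pos x1D by auto
    with op obtain e where e: "e > 0" "ball x1 e \<subseteq> ?U" by (meson openE)
    define q where "q = w x1 * p1 (?s x1) / 2"
    have "(LINT x|lborel. q * indicator (ball x1 e) x) \<le> J"
      unfolding J_def
    proof (rule integral_mono)
      show "integrable lborel (\<lambda>x. q * indicator (ball x1 e) x)"
        by (intro integrable_mult_right integrable_real_indicator) (auto simp: emeasure_bounded_finite[simplified])
      show "q * indicator (ball x1 e) x \<le> ?k1 x" for x
      proof (cases "x \<in> ball x1 e")
        case True
        then have "x \<in> ?U" using e by blast
        then show ?thesis using True by (auto simp: q_def)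
      next
        case False
        then show ?thesis using w(3)[of x] 1(4) by (auto simp: indicator_def)
      qed
    qed (rule Ik1)
    moreover have "(LINT x|lborel. q * indicator (ball x1 e) x) = q * measure lborel (ball x1 e)"
      by simp
    moreover have "q * measure lborel (ball x1 e) > 0"
      using pos content_ball_pos[OF e(1), of x1] by (simp add: q_def)
    ultimately show ?thesis by linarith
  qed
  \<comment> \<open>\<open>m\<close> is the common mass of the kernels: \<open>w \<le> \<eta>\<close> on the small ring gives \<open>J \<le> \<eta> * m < J\<close>.\<close>
  define \<eta> where "\<eta> = J / (m + 1)"
  have \<eta>: "\<eta> > 0" "\<eta> * m < J" using J0 m0 by (auto simp: \<eta>_def field_simps)
  have "isCont w x0" using w(2,4) x1D continuous_on_eq_continuous_at by blast
  then obtain d where d: "d > 0" "\<And>x. dist x x0 < d \<Longrightarrow> \<bar>w x - w x0\<bar> < \<eta>"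
    using \<eta>(1) unfolding continuous_at_eps_delta dist_real_def by blast
  define \<epsilon> where "\<epsilon> = min \<alpha> (d\<^sup>2 / 2)"
  have \<epsilon>: "0 < \<epsilon>" "\<epsilon> \<le> \<alpha>" "\<epsilon> < d\<^sup>2" using \<alpha> d by (auto simp: \<epsilon>_def min_def)
  obtain p2 Q2 where 2: "\<And>k. Ck_real k p2" "\<And>k. Ck_real k Q2" "\<And>s. (Q2 has_real_derivative p2 s) (at s)"
    "\<And>s. p2 s \<ge> 0" "\<And>s. p2 s > 0 \<longleftrightarrow> \<epsilon> / 2 < s \<and> s < \<epsilon>"
    "\<And>s. s \<le> \<epsilon> / 2 \<Longrightarrow> Q2 s = 0" "\<And>s. s \<ge> \<epsilon> \<Longrightarrow> Q2 s = 1"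
    by (rule unit_bump[of "\<epsilon> / 2" \<epsilon>]) (use \<epsilon>(1) in simp, rule that)
  have \<epsilon>\<rho>: "\<epsilon> \<le> \<rho>\<^sup>2" "\<epsilon> / 2 \<le> \<alpha>" using \<epsilon> \<alpha> s\<rho> by auto
  have p20: "p2 s = 0" if "s > \<rho>\<^sup>2" for s using 2(4,5)[of s] that \<epsilon>\<rho> by linarith
  have Q10: "Q1 s = 0" if "s \<le> \<epsilon> / 2" for s using 1(6) that \<epsilon>\<rho> by simp
  have Q21: "Q2 s = 1" if "s \<ge> \<rho>\<^sup>2" for s using 2(7) that \<epsilon>\<rho> by simp
  have \<epsilon>2: "0 < \<epsilon> / 2" using \<epsilon> by simp
  note avg = harmonic_ring_averages[OF _ _ \<epsilon>2 sub 1(1-3) Q10 1(7) p10 2(1-3,6) Q21 p20]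
  have wk: "J = (LINT x|lborel. indicator D x * (w x * p2 (?s x)))"
    "integrable lborel (\<lambda>x. indicator D x * (w x * p2 (?s x)))"
    unfolding J_def using avg(1,3)[OF w(1,2)] by blast+
  have ck: "m = (LINT x|lborel. indicator D x * (1 * p2 (?s x)))"
    "integrable lborel (\<lambda>x. indicator D x * (1 * p2 (?s x)))"
    unfolding m_def using avg(1,3)[OF harmonic_const continuous_on_const] by blast+
  have "J \<le> (LINT x|lborel. \<eta> * (indicator D x * (1 * p2 (?s x))))"
    unfolding wk(1)
  proof (rule integral_mono)
    show "indicator D x * (w x * p2 (?s x)) \<le> \<eta> * (indicator D x * (1 * p2 (?s x)))" for x
    proof (cases "p2 (?s x) = 0")
      case False
      then have "p2 (?s x) > 0" using 2(4)[of "?s x"] by linarith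
      then have "?s x < d\<^sup>2" using 2(5) \<epsilon> by force
      then have "dist x x0 < d" using d(1) by (metis power_less_imp_less_base less_imp_le dist_commute)
      then have "w x \<le> \<eta>" using d(2)[of x] x0 by auto
      then show ?thesis using 2(4) by (auto simp: indicator_def intro!: mult_right_mono)
    qed simp
  qed (use wk ck in auto)
  then have "J \<le> \<eta> * m" using ck(1) by simp
  with \<eta>(2) show False by simp
qed

text \<open>
  Among the points where the maximum over the closure is attained, take one whose first coordinate is
  largest. It cannot be an interior point, since the maximum would then also be attained slightly
  further to the right.
\<close>
lemma harmonic_maximum_principle:
  fixes u :: "real^2 \<Rightarrow> real"
  assumes D: "open D" "bounded D" and u: "continuous_on (closure D) u" "harmonic_in D u"
    and bd: "\<And>z. z \<in> frontier D \<Longrightarrow> u z \<le> K" and x: "x \<in> D"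
  shows "u x \<le> K"
proof -
  have cD: "compact (closure D)" using D(2) by (simp add: compact_closure)
  obtain xm where xm: "xm \<in> closure D" "\<And>y. y \<in> closure D \<Longrightarrow> u y \<le> u xm"
    using continuous_attains_sup[OF cD _ u(1)] x closure_subset by blast
  define S where "S = {y \<in> closure D. u y = u xm}"
  have "closed S"
    unfolding S_def using continuous_closed_preimage_constant[OF u(1) closed_closure] .
  moreover have "S \<subseteq> closure D" by (auto simp: S_def)
  ultimately have "compact S" using cD by (metis compact_Int_closed inf.absorb2)
  moreover have "xm \<in> S" using xm by (simp add: S_def)
  ultimately obtain x0 where x0: "x0 \<in> S" "\<And>y. y \<in> S \<Longrightarrow> y $ 1 \<le> x0 $ 1"
    using continuous_attains_sup[of S "\<lambda>y. y $ 1"]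
      linear_continuous_on[OF bounded_linear_vec_nth[of 1], of S]
    by (metis emptyE)
  have "x0 \<notin> D"
  proof
    assume "x0 \<in> D"
    with D(1) obtain \<rho> where \<rho>: "\<rho> > 0" "cball x0 \<rho> \<subseteq> D" by (meson open_contains_cball)
    have cu: "continuous_on D u" using u(1) closure_subset continuous_on_subset by blast
    let ?y = "x0 + (\<rho> / 2) *\<^sub>R axis 1 1"
    have y: "?y \<in> ball x0 \<rho>" using \<rho>(1) by (simp add: dist_norm norm_axis_1)
    have "u xm - u ?y = 0"
    proof (rule harmonic_nonneg_zero_near[OF _ _ _ D(1) _ \<rho>(2) y])
      show "harmonic_in D (\<lambda>x. u xm - u x)"
        by (intro harmonic_in_diff harmonic_const u cu continuous_on_const)
      show "continuous_on D (\<lambda>x. u xm - u x)" by (intro continuous_intros cu)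
      show "u xm - u x \<ge> 0" if "x \<in> D" for x using xm(2) that closure_subset by fastforce
      show "u xm - u x0 = 0" using x0 by (simp add: S_def)
    qed
    moreover have "?y \<in> closure D" using y \<rho> closure_subset by (metis ball_subset_cball subsetD)
    ultimately have "?y \<in> S" by (simp add: S_def)
    from x0(2)[OF this] show False using \<rho>(1) by simp
  qed
  then have "x0 \<in> frontier D" using x0 D(1) by (simp add: frontier_def S_def interior_open)
  then have "u xm \<le> K" using bd x0 by (force simp: S_def)
  moreover have "u x \<le> u xm" using xm(2) x closure_subset by blast
  ultimately show ?thesis by simp
qed

section \<open>The boundary of a polygon\<close>

lemma polygon_arc:
  assumes poly: "is_polygon E xs" and k: "1 \<le> k" "k < length xs"
  shows "\<exists>g. arc g \<and> pathstart g = xs ! 0 \<and> pathfinish g = xs ! k \<and> path_image g = (\<Union>i<k. edge xs i)"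
  using k
proof (induction k rule: nat_induct_at_least)
  case base
  have N: "length xs \<ge> 3" "distinct xs" using poly by (auto simp: is_polygon_def)
  then have "xs ! 0 \<noteq> xs ! 1" by (subst nth_eq_iff_index_eq) auto
  then show ?case
    using N by (intro exI[of _ "linepath (xs ! 0) (xs ! 1)"]) (auto simp: edge_def lessThan_Suc)
next
  case (Suc k)
  have N: "length xs \<ge> 3" "distinct xs" and ni: "nonintersecting xs"
    using poly by (auto simp: is_polygon_def)
  from Suc obtain g where g: "arc g" "pathstart g = xs ! 0" "pathfinish g = xs ! k"
    "path_image g = (\<Union>i<k. edge xs i)" by auto
  have ek: "edge xs k = closed_segment (xs ! k) (xs ! Suc k)"
    using Suc.prems by (simp add: edge_def)
  let ?l = "linepath (xs ! k) (xs ! Suc k)"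
  have ne: "xs ! k \<noteq> xs ! Suc k" using N Suc.prems by (simp add: nth_eq_iff_index_eq)
  have "path_image g \<inter> path_image ?l \<subseteq> {pathstart ?l}"
  proof -
    have "edge xs i \<inter> edge xs k \<subseteq> {xs ! k}" if "i < k" for i
    proof -
      have "edge xs i \<inter> edge xs k = edge_ends xs i \<inter> edge_ends xs k"
        using ni that Suc.prems by (simp add: nonintersecting_def)
      also have "\<dots> \<subseteq> {xs ! k}"
        using that Suc.prems N by (auto simp: edge_ends_def nth_eq_iff_index_eq)
      finally show ?thesis .
    qed
    then show ?thesis using g(4) ek by auto
  qed
  then have "arc (g +++ ?l)"
    using g ne by (intro arc_join) auto
  moreover have "path_image (g +++ ?l) = (\<Union>i<Suc k. edge xs i)"
    using g ek by (subst path_image_join) (auto simp: lessThan_Suc)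
  ultimately show ?case using g by (intro exI[of _ "g +++ ?l"]) auto
qed

text \<open>
  The Jordan--Brouwer theorem applies to the simple closed path along the edges, and the connected set
  \<open>E\<close> is a component of the complement of that path. This matters because a function in \<open>V_h\<close> is
  tied to its values on the edges only by continuity on the closure of \<open>E\<close>.
\<close>
lemma polygon_frontier:
  assumes poly: "is_polygon E xs" and E: "connected E" "E \<noteq> {}"
  shows "frontier E = (\<Union>i<length xs. edge xs i)"
proof -
  let ?N = "length xs"
  let ?\<Gamma> = "\<Union>i<?N. edge xs i"
  have N: "?N \<ge> 3" "distinct xs" and ni: "nonintersecting xs" and Ein: "E = inside ?\<Gamma>"
    using poly by (auto simp: is_polygon_def)
  have k: "1 \<le> ?N - 1" "?N - 1 < ?N" using N by linarith+
  obtain g where g: "arc g" "pathstart g = xs ! 0" "pathfinish g = xs ! (?N - 1)"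
    "path_image g = (\<Union>i<?N - 1. edge xs i)"
    using polygon_arc[OF poly k] by blast
  have S: "Suc (?N - Suc 0) = ?N" using N by simp
  have ek: "edge xs (?N - 1) = closed_segment (xs ! (?N - 1)) (xs ! 0)"
    by (simp add: edge_def S)
  let ?l = "linepath (xs ! (?N - 1)) (xs ! 0)"
  have "path_image g \<inter> path_image ?l \<subseteq> {pathstart g, pathstart ?l}"
  proof -
    have "edge xs i \<inter> edge xs (?N - 1) \<subseteq> {xs ! 0, xs ! (?N - 1)}" if "i < ?N - 1" for i
    proof -
      have "edge xs i \<inter> edge xs (?N - 1) = edge_ends xs i \<inter> edge_ends xs (?N - 1)"
        using ni that N by (simp add: nonintersecting_def)
      also have "\<dots> \<subseteq> {xs ! 0, xs ! (?N - 1)}"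
        by (auto simp: edge_ends_def S)
      finally show ?thesis .
    qed
    then show ?thesis using g ek by auto
  qed
  moreover have "xs ! (?N - 1) \<noteq> xs ! 0" using N by (subst nth_eq_iff_index_eq) auto
  ultimately have sp: "simple_path (g +++ ?l)"
    using g by (intro simple_path_join_loop) auto
  have "{..<?N} = insert (?N - 1) {..<?N - 1}" using N by auto
  then have im: "path_image (g +++ ?l) = ?\<Gamma>"
    using g ek by (subst path_image_join) auto
  have "?\<Gamma> homeomorphic sphere (0::complex) 1"
    using homeomorphic_simple_path_image_circle[OF sp, of 1 0] g im by auto
  then have hom: "?\<Gamma> homeomorphic sphere (0::real^2) 1"
    using homeomorphic_spheres_gen[of 1 1 "0::complex" "0::real^2"] homeomorphic_trans by fastforce
  obtain c where c: "c \<in> E" using E by blast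
  have sub: "E \<subseteq> - ?\<Gamma>" using Ein inside_no_overlap by blast
  have "E = connected_component_set (- ?\<Gamma>) c"
  proof
    show "E \<subseteq> connected_component_set (- ?\<Gamma>) c"
      using connected_component_maximal[OF c E(1) sub] .
    show "connected_component_set (- ?\<Gamma>) c \<subseteq> E"
      using inside_same_component[of ?\<Gamma> c] c Ein by auto
  qed
  then have "E \<in> components (- ?\<Gamma>)"
    using c sub by (auto intro: componentsI)
  then show ?thesis
    by (rule Jordan_Brouwer_frontier[OF hom]) simp
qed

section \<open>Star-shaped domains near an edge\<close>

text \<open>
  Star-shapedness passes to boundary points \<open>y\<close>, and only the end \<open>y\<close> of the segment may leave
  \<open>E\<close>: replace \<open>y\<close> by a nearby point of \<open>E\<close> and compensate by moving \<open>b\<close> within the open ball.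
\<close>
lemma star_shaped_closure:
  assumes star: "star_shaped_wrt E (ball c r)" and y: "y \<in> closure E" and b: "b \<in> ball c r"
    and l: "0 < l" "l \<le> 1"
  shows "(1 - l) *\<^sub>R y + l *\<^sub>R b \<in> E"
proof -
  define e where "e = r - dist c b"
  have e: "e > 0" using b by (simp add: e_def)
  obtain y' where y': "y' \<in> E" "dist y' y < l * e"
    using y e l by (meson closure_approachable mult_pos_pos)
  define b' where "b' = b + ((1 - l) / l) *\<^sub>R (y - y')"
  have "dist b b' = ((1 - l) / l) * dist y' y"
    using l by (simp add: b'_def dist_norm norm_minus_commute)
  also have "\<dots> \<le> ((1 - l) / l) * (l * e)"
    using y' l by (intro mult_left_mono) auto
  also have "\<dots> = (1 - l) * e" using l by simp
  also have "\<dots> < e" using l e by (simp add: algebra_simps)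
  finally have "dist c b' < r"
    using dist_triangle[of c b' b] by (simp add: e_def)
  then have "closed_segment b' y' \<subseteq> E"
    using star y' by (auto simp: star_shaped_wrt_def)
  moreover have "(1 - l) *\<^sub>R y + l *\<^sub>R b = (1 - l) *\<^sub>R y' + l *\<^sub>R b'"
    using l by (simp add: b'_def scaleR_right_distrib scaleR_right_diff_distrib)
  moreover have "(1 - l) *\<^sub>R y' + l *\<^sub>R b' \<in> closed_segment b' y'"
    using l unfolding closed_segment_def by (auto intro!: exI[of _ "1 - l"])
  ultimately show ?thesis by auto
qed

lemma unit_normal_ex:
  fixes u :: "real^2"
  assumes "u \<noteq> 0"
  obtains n where "norm n = 1" "n \<bullet> u = 0" "\<And>w. n \<bullet> w = 0 \<Longrightarrow> \<exists>s. w = s *\<^sub>R u"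
proof -
  define m :: "real^2" where "m = vector [- u $ 2, u $ 1]"
  have mu: "m \<bullet> w = - u $ 2 * w $ 1 + u $ 1 * w $ 2" for w
    by (simp add: m_def inner_vec_def sum_2)
  have "m \<noteq> 0"
    using assms by (simp add: vec_eq_iff forall_2 m_def) auto
  then have nm: "norm m > 0" by simp
  have u2: "u \<bullet> u = u $ 1 * u $ 1 + u $ 2 * u $ 2" by (simp add: inner_vec_def sum_2)
  have up: "u \<bullet> u > 0" using assms by simp
  show thesis
  proof
    show "norm ((1 / norm m) *\<^sub>R m) = 1" using nm by simp
    show "((1 / norm m) *\<^sub>R m) \<bullet> u = 0" by (simp add: mu)
    fix w assume "((1 / norm m) *\<^sub>R m) \<bullet> w = 0"
    then have w: "u $ 1 * w $ 2 = u $ 2 * w $ 1" using nm by (simp add: mu)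
    define q where "q = u $ 1 * w $ 1 + u $ 2 * w $ 2"
    have "w $ 1 * (u \<bullet> u) = q * u $ 1" "w $ 2 * (u \<bullet> u) = q * u $ 2"
      using w unfolding q_def u2 by algebra+
    then have "w = (q / (u \<bullet> u)) *\<^sub>R u"
      using up by (simp add: vec_eq_iff forall_2 field_simps)
    then show "\<exists>s. w = s *\<^sub>R u" by blast
  qed
qed

text \<open>
  By \<open>star_shaped_closure\<close> no point of the frontier lies strictly between a point of the ball and
  a point of the closure. So the line through the edge misses the ball: a point of the ball on that line
  would have an end of the edge strictly between itself and the other end. The centre
  \<open>c\<close> is therefore at distance at least \<open>r\<close> from the line. Suppose that a point near \<open>y0\<close>
  contradicts one of the two last conclusions. The line through it and \<open>c\<close> meets the line of the edge at
  a point \<open>z\<close> that is still close to \<open>y0\<close>, thus on the edge. Then \<open>z\<close>, or the given frontier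
  point, lies strictly between \<open>c\<close> and a point of the closure.
\<close>
lemma half_disc_at_edge:
  fixes A B c y0 :: "real^2"
  assumes E: "open E" and star: "star_shaped_wrt E (ball c r)" and r: "r > 0"
    and h: "\<And>x. x \<in> closure E \<Longrightarrow> dist x c \<le> h"
    and AB: "A \<noteq> B" "closed_segment A B \<subseteq> frontier E"
    and y0: "y0 \<in> closed_segment A B" "d \<le> dist y0 A" "d \<le> dist y0 B"
    and R: "0 < R" "R \<le> r / 2" "R * (1 + 2 * h / r) \<le> d"
  obtains n where "norm n = 1" "\<And>z. z \<in> closed_segment A B \<Longrightarrow> n \<bullet> (z - y0) = 0"
    "\<And>x. x \<in> closure E \<Longrightarrow> dist y0 x < R \<Longrightarrow> n \<bullet> (x - y0) \<ge> 0"
    "frontier E \<inter> ball y0 R \<subseteq> closed_segment A B"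
proof -
  let ?u = "B - A"
  have u: "?u \<noteq> 0" using AB by simp
  have notin: "z \<notin> E" if "z \<in> closed_segment A B" for z
    using that AB(2) E frontier_disjoint_eq by (metis disjoint_iff subsetD)
  have seg: "z \<in> closed_segment A B \<longleftrightarrow> (\<exists>s. 0 \<le> s \<and> s \<le> 1 \<and> z = A + s *\<^sub>R ?u)" for z
    unfolding closed_segment_def by (auto simp: algebra_simps)
  have clos: "z \<in> closure E" if "z \<in> closed_segment A B" for z
    using that AB(2) by (auto simp: frontier_def)
  obtain s0 where s0: "0 \<le> s0" "s0 \<le> 1" "y0 = A + s0 *\<^sub>R ?u" using y0 seg by blast
  obtain n0 where n0: "norm n0 = 1" "n0 \<bullet> ?u = 0" "\<And>w. n0 \<bullet> w = 0 \<Longrightarrow> \<exists>s. w = s *\<^sub>R ?u"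
    using unit_normal_ex[OF u] by metis
  have line: "\<exists>s. x = A + s *\<^sub>R ?u" if x: "n0 \<bullet> (x - y0) = 0" for x
  proof -
    from n0(3)[OF x] obtain s where s: "x - y0 = s *\<^sub>R ?u" by blast
    then have "x = A + (s0 + s) *\<^sub>R ?u" unfolding s0(3) by (simp add: algebra_simps)
    then show ?thesis by blast
  qed
  have off: "n0 \<bullet> (b - y0) \<noteq> 0" if b: "b \<in> ball c r" for b
  proof
    assume "n0 \<bullet> (b - y0) = 0"
    then obtain s where s: "b = A + s *\<^sub>R ?u" using line by blast
    have bE: "b \<in> E" using star b by (auto simp: star_shaped_wrt_def)
    consider "s < 0" | "0 \<le> s" "s \<le> 1" | "s > 1" by linarith
    then show False
    proof cases
      case 1
      define l where "l = 1 / (1 - s)"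
      have l: "0 < l" "l \<le> 1" "l * (1 - s) = 1" using 1 by (auto simp: l_def)
      have "(1 - l) *\<^sub>R B + l *\<^sub>R b = A + (1 - l * (1 - s)) *\<^sub>R ?u"
        unfolding s by (simp add: algebra_simps)
      then have "(1 - l) *\<^sub>R B + l *\<^sub>R b = A" using l by simp
      moreover have "(1 - l) *\<^sub>R B + l *\<^sub>R b \<in> E"
        by (rule star_shaped_closure[OF star clos b l(1,2)]) simp
      ultimately show False using notin[of A] by simp
    next
      case 2
      then show False using notin[of b] bE seg s by blast
    next
      case 3
      define l where "l = 1 / s"
      have l: "0 < l" "l \<le> 1" "l * s = 1" using 3 by (auto simp: l_def)
      have "(1 - l) *\<^sub>R A + l *\<^sub>R b = A + (l * s) *\<^sub>R ?u"
        unfolding s by (simp add: algebra_simps)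
      then have "(1 - l) *\<^sub>R A + l *\<^sub>R b = B" using l by simp
      moreover have "(1 - l) *\<^sub>R A + l *\<^sub>R b \<in> E"
        by (rule star_shaped_closure[OF star clos b l(1,2)]) simp
      ultimately show False using notin[of B] by simp
    qed
  qed
  have rc: "\<bar>n0 \<bullet> (c - y0)\<bar> \<ge> r"
  proof (rule ccontr)
    assume "\<not> ?thesis"
    then have "c - (n0 \<bullet> (c - y0)) *\<^sub>R n0 \<in> ball c r" using n0 by (simp add: dist_norm)
    from off[OF this] show False
      using n0(1) by (simp add: inner_diff_right flip: power2_norm_eq_inner)
  qed
  define n where "n = sgn (n0 \<bullet> (c - y0)) *\<^sub>R n0"
  have sg: "sgn (n0 \<bullet> (c - y0)) \<noteq> 0" using rc r by (auto simp: sgn_0_0)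
  have n: "norm n = 1" "n \<bullet> ?u = 0" using n0 sg by (auto simp: n_def sgn_if)
  have nline: "\<exists>s. x = A + s *\<^sub>R ?u" if "n \<bullet> (x - y0) = 0" for x
    using that line[of x] sg by (simp add: n_def)
  have nc: "n \<bullet> (c - y0) \<ge> r"
    using rc by (simp add: n_def linordered_idom_class.abs_sgn mult.commute)
  have nseg: "n \<bullet> (z - y0) = 0" if z: "z \<in> closed_segment A B" for z
  proof -
    obtain s where "z = A + s *\<^sub>R ?u" using z seg by blast
    then have "z - y0 = (s - s0) *\<^sub>R ?u" unfolding s0(3) by (simp add: algebra_simps)
    then show ?thesis using n(2) by simp
  qed
  have near: "z \<in> closed_segment A B" if z: "n \<bullet> (z - y0) = 0" "dist y0 z < d" for z
  proof -
    obtain s where s: "z = A + s *\<^sub>R ?u" using nline[OF z(1)] by blast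
    have "y0 - z = (s0 - s) *\<^sub>R ?u" "y0 - A = s0 *\<^sub>R ?u" "y0 - B = (s0 - 1) *\<^sub>R ?u"
      unfolding s s0(3) by (simp_all add: algebra_simps)
    then have "dist y0 z = \<bar>s0 - s\<bar> * norm ?u" "dist y0 A = s0 * norm ?u" "dist y0 B = (1 - s0) * norm ?u"
      using s0 by (simp_all add: dist_norm)
    then have "\<bar>s0 - s\<bar> * norm ?u < s0 * norm ?u" "\<bar>s0 - s\<bar> * norm ?u < (1 - s0) * norm ?u"
      using y0 z by linarith+
    then have "\<bar>s0 - s\<bar> < s0" "\<bar>s0 - s\<bar> < 1 - s0" using u by simp_all
    then have "0 \<le> s" "s \<le> 1" by linarith+
    then show ?thesis using seg s by blast
  qed
  have h0: "h \<ge> 0" using h[OF clos[OF y0(1)]] zero_le_dist[of y0 c] by linarith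
  have tb: "\<bar>n \<bullet> w\<bar> \<le> norm w" for w using Cauchy_Schwarz_ineq2[of n w] n by simp
  have side: "n \<bullet> (x - y0) \<ge> 0" if x: "x \<in> closure E" "dist y0 x < R" for x
  proof (rule ccontr)
    define t where "t = - (n \<bullet> (x - y0))"
    assume "\<not> ?thesis"
    then have t: "t > 0" by (simp add: t_def)
    have tR: "t < R" using tb[of "x - y0"] x(2) by (simp add: t_def dist_norm norm_minus_commute)
    \<comment> \<open>\<open>x\<close> is on the far side of the line; \<open>z\<close> is the point where the segment to \<open>c\<close> crosses it.\<close>
    define l where "l = t / (n \<bullet> (c - y0) + t)"
    have l: "0 < l" "l \<le> 1" using t nc r by (auto simp: l_def)
    have "l \<le> t / r" unfolding l_def using t nc r by (intro divide_left_mono) auto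
    also have "\<dots> \<le> R / r" using tR r by (simp add: divide_right_mono)
    finally have lR: "l \<le> R / r" .
    define z where "z = (1 - l) *\<^sub>R x + l *\<^sub>R c"
    have "z \<in> E" unfolding z_def
      by (rule star_shaped_closure[OF star x(1) _ l]) (use r in simp)
    have lt: "l * (n \<bullet> (c - y0) + t) = t" using t nc r by (simp add: l_def)
    have "z - y0 = (1 - l) *\<^sub>R (x - y0) + l *\<^sub>R (c - y0)" by (simp add: z_def algebra_simps)
    then have "n \<bullet> (z - y0) = (1 - l) * (- t) + l * (n \<bullet> (c - y0))"
      by (simp only: inner_add_right inner_scaleR_right) (simp add: t_def)
    also have "\<dots> = 0" using lt by (simp add: algebra_simps)
    finally have nz: "n \<bullet> (z - y0) = 0" .
    have "x - z = l *\<^sub>R (x - c)" by (simp add: z_def algebra_simps)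
    then have "dist x z = l * dist x c" using l by (simp add: dist_norm)
    also have "\<dots> \<le> (R / r) * h" using lR h[OF x(1)] l R r by (intro mult_mono) auto
    finally have "dist y0 z < R + (R / r) * h" using dist_triangle[of y0 z x] x(2) by linarith
    also have "\<dots> \<le> R * (1 + 2 * h / r)" using h0 R r by (simp add: field_simps)
    also have "\<dots> \<le> d" by (rule R(3))
    finally have "z \<in> closed_segment A B" using near nz by blast
    with \<open>z \<in> E\<close> notin show False by blast
  qed
  have "frontier E \<inter> ball y0 R \<subseteq> closed_segment A B"
  proof
    fix y assume y: "y \<in> frontier E \<inter> ball y0 R"
    then have yc: "y \<in> closure E" and yR: "dist y0 y < R" and yE: "y \<notin> E"
      using E by (auto simp: frontier_def interior_open)
    define t where "t = n \<bullet> (y - y0)"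
    have t0: "t \<ge> 0" using side[OF yc yR] by (simp add: t_def)
    have tR: "t < R" using tb[of "y - y0"] yR by (simp add: t_def dist_norm norm_minus_commute)
    \<comment> \<open>\<open>z\<close> is the point where the ray from \<open>c\<close> through \<open>y\<close> reaches the line, beyond \<open>y\<close>.\<close>
    define s where "s = t / (n \<bullet> (c - y0) - t)"
    have den: "n \<bullet> (c - y0) - t \<ge> r / 2" using tR R(2) nc by linarith
    then have den0: "n \<bullet> (c - y0) - t > 0" using r by linarith
    have s: "s \<ge> 0" using t0 den0 by (simp add: s_def)
    have "s \<le> t / (r / 2)" unfolding s_def using t0 den r den0 by (intro divide_left_mono) auto
    also have "\<dots> \<le> R / (r / 2)" using tR r by (intro divide_right_mono) auto
    finally have sR: "s \<le> 2 * R / r" by (simp add: mult.commute)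
    define z where "z = y + s *\<^sub>R (y - c)"
    have st: "s * (n \<bullet> (c - y0) - t) = t" using den0 by (simp add: s_def)
    have "z - y0 = (y - y0) + s *\<^sub>R ((y - y0) - (c - y0))" by (simp add: z_def)
    then have "n \<bullet> (z - y0) = t + s * (t - n \<bullet> (c - y0))"
      by (simp only: inner_add_right inner_scaleR_right inner_diff_right[of n "y - y0" "c - y0"])
        (simp add: t_def)
    also have "\<dots> = 0" using st by (simp add: algebra_simps)
    finally have nz: "n \<bullet> (z - y0) = 0" .
    have "dist y z = s * dist y c" using s by (simp add: z_def dist_norm)
    also have "\<dots> \<le> (2 * R / r) * h" using sR h[OF yc] s R r by (intro mult_mono) auto
    finally have "dist y0 z < R + (2 * R / r) * h" using dist_triangle[of y0 z y] yR by linarith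
    also have "\<dots> = R * (1 + 2 * h / r)" using r by (simp add: field_simps)
    also have "\<dots> \<le> d" by (rule R(3))
    finally have zs: "z \<in> closed_segment A B" using near nz by blast
    show "y \<in> closed_segment A B"
    proof (cases "s = 0")
      case True
      then show ?thesis using zs by (simp add: z_def)
    next
      case False
      define l where "l = s / (1 + s)"
      have l: "0 < l" "l \<le> 1" using False s by (auto simp: l_def)
      have l1: "(1 - l) * (1 + s) = 1" "(1 - l) * s = l" using s by (auto simp: l_def field_simps)
      have "(1 - l) *\<^sub>R z + l *\<^sub>R c = ((1 - l) * (1 + s)) *\<^sub>R y + (l - (1 - l) * s) *\<^sub>R c"
        by (simp add: z_def algebra_simps)
      then have "(1 - l) *\<^sub>R z + l *\<^sub>R c = y" using l1 by simp
      moreover have "(1 - l) *\<^sub>R z + l *\<^sub>R c \<in> E"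
        by (rule star_shaped_closure[OF star clos[OF zs] _ l]) (use r in simp)
      ultimately show ?thesis using yE by simp
    qed
  qed
  with n(1) nseg side show thesis using that by blast
qed

section \<open>Packing and comparison arguments\<close>

lemma measure_ball_plane:
  fixes a :: "real^2"
  assumes "q \<ge> 0"
  shows "measure lebesgue (ball a q) = q\<^sup>2 * measure lebesgue (ball (0::real^2) 1)"
  using content_ball_conv_unit_ball[OF assms, of a] by (simp add: measure_completion)

text \<open>
  The discs of radius \<open>R / 2\<close> around the points are disjoint and lie in the disc of radius \<open>h + R\<close>
  around \<open>c\<close>; compare areas.
\<close>
lemma card_separated_le:
  fixes y :: "nat \<Rightarrow> real^2"
  assumes R: "R > 0" and h: "h \<ge> 0" and y: "\<And>i. i < N \<Longrightarrow> dist c (y i) \<le> h"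
    and sep: "\<And>i j. i < N \<Longrightarrow> j < N \<Longrightarrow> i \<noteq> j \<Longrightarrow> R \<le> dist (y i) (y j)"
  shows "real N \<le> (2 * (h + R) / R)\<^sup>2"
proof -
  let ?V = "measure lebesgue (ball (0::real^2) 1)"
  have V: "?V > 0" using content_ball_pos[of 1 "0::real^2"] by (simp add: measure_completion)
  have "disjoint_family_on (\<lambda>i. ball (y i) (R / 2)) {..<N}"
    unfolding disjoint_family_on_def
  proof (intro ballI impI, rule ccontr)
    fix i j assume ij: "i \<in> {..<N}" "j \<in> {..<N}" "i \<noteq> j" and "ball (y i) (R / 2) \<inter> ball (y j) (R / 2) \<noteq> {}"
    then obtain z where "dist (y i) z < R / 2" "dist (y j) z < R / 2" by auto
    then have "dist (y i) (y j) < R" using dist_triangle_half_l by blast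
    then show False using sep ij by fastforce
  qed
  then have "measure lebesgue (\<Union>i<N. ball (y i) (R / 2)) = (\<Sum>i<N. measure lebesgue (ball (y i) (R / 2)))"
    by (intro measure_finite_Union) (auto simp: emeasure_bounded_finite[simplified, THEN less_imp_neq])
  also have "\<dots> = (\<Sum>i<N. (R / 2)\<^sup>2 * ?V)" by (intro sum.cong refl measure_ball_plane) (use R in simp)
  also have "\<dots> = N * ((R / 2)\<^sup>2 * ?V)" by simp
  finally have "N * ((R / 2)\<^sup>2 * ?V) = measure lebesgue (\<Union>i<N. ball (y i) (R / 2))" ..
  also have "\<dots> \<le> measure lebesgue (ball c (h + R))"
  proof (rule measure_mono_fmeasurable)
    show "(\<Union>i<N. ball (y i) (R / 2)) \<subseteq> ball c (h + R)"
    proof clarify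
      fix i x assume "i < N" "x \<in> ball (y i) (R / 2)"
      then show "x \<in> ball c (h + R)" using y[of i] dist_triangle[of c x "y i"] R by simp
    qed
  qed auto
  also have "\<dots> = (h + R)\<^sup>2 * ?V" by (rule measure_ball_plane) (use h R in simp)
  finally have "N * (R / 2)\<^sup>2 \<le> (h + R)\<^sup>2" using V by simp
  then have "real N \<le> (h + R)\<^sup>2 / (R / 2)\<^sup>2" using R by (simp add: pos_le_divide_eq)
  also have "\<dots> = (2 * (h + R) / R)\<^sup>2" by (simp add: power2_eq_square field_simps)
  finally show ?thesis .
qed

text \<open>
  In Cartesian coordinates \<open>(s, t)\<close> with origin \<open>y0\<close> and the \<open>t\<close>-axis in direction \<open>n\<close>, this
  is \<open>K * (s\<^sup>2 - t\<^sup>2 + 2 * R * t)\<close>.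
\<close>
lemma barrier_harmonic:
  fixes n y0 :: "real^2" and K R :: real
  assumes n: "norm n = 1"
  defines "H \<equiv> \<lambda>x. K * ((dist y0 x)\<^sup>2 - 2 * (n \<bullet> (x - y0))\<^sup>2 + 2 * R * (n \<bullet> (x - y0)))"
  shows "Ck k H" "laplacian H x = 0"
proof -
  have eq: "H = (\<lambda>x. K * (((axis 1 1 \<bullet> x - y0 $ 1) * (axis 1 1 \<bullet> x - y0 $ 1)
      + (axis 2 1 \<bullet> x - y0 $ 2) * (axis 2 1 \<bullet> x - y0 $ 2)
      - 2 * ((n \<bullet> x - n \<bullet> y0) * (n \<bullet> x - n \<bullet> y0))) + 2 * R * (n \<bullet> x - n \<bullet> y0)))"
    unfolding H_def dist_norm power2_norm_eq_inner inner_axis'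
    by (simp add: fun_eq_iff inner_vec_def[of "_ - _"] sum_2 inner_diff_right power2_eq_square algebra_simps)
  show "Ck k H" unfolding eq by (intro Ck_mult Ck_add Ck_diff Ck_inner Ck_const)
  have p: "partial_deriv i H = (\<lambda>x. K * (2 * (x $ i - y0 $ i) - 4 * (n \<bullet> (x - y0)) * n $ i + 2 * R * n $ i))" for i
  proof
    fix x
    have "(H has_derivative (\<lambda>w. K * (2 * ((x - y0) \<bullet> w) - 4 * (n \<bullet> (x - y0)) * (n \<bullet> w) + 2 * R * (n \<bullet> w)))) (at x)"
      unfolding H_def dist_norm power2_norm_eq_inner
      by (auto intro!: derivative_eq_intros simp: inner_commute algebra_simps inner_diff_left inner_diff_right)
    from partial_deriv_eq[OF this, of i]
    show "partial_deriv i H x = K * (2 * (x $ i - y0 $ i) - 4 * (n \<bullet> (x - y0)) * n $ i + 2 * R * n $ i)"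
      by (simp add: inner_axis)
  qed
  have pp: "partial_deriv i (partial_deriv i H) x = K * (2 - 4 * n $ i * n $ i)" for i
  proof -
    have "((\<lambda>x. K * (2 * (axis i 1 \<bullet> x - y0 $ i) - 4 * (n \<bullet> (x - y0)) * n $ i + 2 * R * n $ i))
        has_derivative (\<lambda>w. K * (2 * (axis i 1 \<bullet> w) - 4 * (n \<bullet> w) * n $ i))) (at x)"
      by (auto intro!: derivative_eq_intros simp: inner_diff_right algebra_simps)
    from partial_deriv_eq[OF this, of i] show ?thesis
      unfolding p by (simp add: inner_axis' inner_axis)
  qed
  have "n $ 1 * n $ 1 + n $ 2 * n $ 2 = 1"
    using n by (simp add: norm_eq_1 inner_vec_def sum_2)
  then show "laplacian H x = 0"
    unfolding laplacian_def pp sum_2 by algebra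
qed

text \<open>
  The barrier \<open>H\<close> is nonnegative on the flat part of the half disc of radius \<open>R\<close>, where
  \<open>v \<ge> M / 2\<close>, and at least \<open>3 * M / 2\<close> on the round part, where \<open>v \<ge> - M\<close>. Hence
  \<open>v \<ge> M / 2 - H\<close> throughout. Near \<open>y0\<close> the barrier is small: it is at most \<open>M / 4\<close> at distance
  below \<open>R / 16\<close>.
\<close>
lemma harmonic_lower_bound_near_edge:
  fixes n y0 :: "real^2"
  assumes E: "open E" and v: "continuous_on (closure E) v" "harmonic_in E v"
    and M: "M \<ge> 0" "\<And>x. x \<in> closure E \<Longrightarrow> \<bar>v x\<bar> \<le> M"
    and R: "R > 0" and n: "norm n = 1"
    and side: "\<And>x. x \<in> closure E \<Longrightarrow> dist y0 x < R \<Longrightarrow> n \<bullet> (x - y0) \<ge> 0"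
    and flat: "\<And>z. z \<in> frontier E \<Longrightarrow> dist y0 z < R \<Longrightarrow> n \<bullet> (z - y0) = 0 \<and> v z \<ge> M / 2"
    and x: "x \<in> E" "dist y0 x < R / 16"
  shows "v x \<ge> M / 4"
proof -
  \<comment> \<open>\<open>K\<close> is such that the barrier is at least \<open>3 * M / 2\<close> on the half circle of radius \<open>R\<close>.\<close>
  define K where "K = 3 * M / (2 * R\<^sup>2)"
  define H where "H x = K * ((dist y0 x)\<^sup>2 - 2 * (n \<bullet> (x - y0))\<^sup>2 + 2 * R * (n \<bullet> (x - y0)))" for x
  have K0: "K \<ge> 0" "K * R\<^sup>2 = 3 * M / 2" using M R by (auto simp: K_def)
  let ?D = "E \<inter> ball y0 R"
  have D: "open ?D" "bounded ?D" using E by (auto intro: bounded_subset[OF bounded_ball])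
  have cl: "closure ?D \<subseteq> closure E" "closure ?D \<subseteq> cball y0 R"
    by (intro closure_mono closure_minimal Int_lower1 le_infI2 ball_subset_cball closed_cball)+
  have CkH: "Ck k H" and lapH: "laplacian H x = 0" for k x
    unfolding H_def using barrier_harmonic[OF n] by blast+
  have contH: "continuous_on S H" for S
    using CkH[of 0] by (auto intro: continuous_on_subset)
  have contv: "continuous_on ?D v"
    using v(1) closure_subset by (metis continuous_on_subset inf.coboundedI1)
  have tle: "\<bar>n \<bullet> (z - y0)\<bar> \<le> dist y0 z" for z
    using Cauchy_Schwarz_ineq2[of n "z - y0"] n by (simp add: dist_norm norm_minus_commute)
  have "M / 2 - H x - v x \<le> 0"
  proof (rule harmonic_maximum_principle[OF D])
    show "continuous_on (closure ?D) (\<lambda>x. M / 2 - H x - v x)"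
      by (intro continuous_intros contH continuous_on_subset[OF v(1)] cl)
    show "harmonic_in ?D (\<lambda>x. M / 2 - H x - v x)"
      by (intro harmonic_in_diff harmonic_const harmonic_in_smooth CkH lapH
          harmonic_in_subset[OF v(2)] contH contv continuous_intros) auto
    show "x \<in> ?D" using x R by auto
    fix z assume z: "z \<in> frontier ?D"
    then have zc: "z \<in> closure E" "dist y0 z \<le> R" using cl by (auto simp: frontier_def)
    show "M / 2 - H z - v z \<le> 0"
    proof (cases "dist y0 z < R")
      case True
      have "z \<notin> ?D" using z by (simp add: frontier_def interior_open[OF D(1)] del: interior_Int)
      then have "z \<notin> E" using True by simp
      then have "z \<in> frontier E" using zc E by (auto simp: frontier_def interior_open)
      from flat[OF this True] have "n \<bullet> (z - y0) = 0" "v z \<ge> M / 2" by auto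
      moreover have "H z \<ge> 0" unfolding H_def using calculation(1) K0 by simp
      ultimately show ?thesis by linarith
    next
      case False
      then have zR: "dist y0 z = R" using zc by simp
      define t where "t = n \<bullet> (z - y0)"
      have "closure ?D \<subseteq> {x. n \<bullet> (x - y0) \<ge> 0}"
      proof (rule closure_minimal)
        show "?D \<subseteq> {x. n \<bullet> (x - y0) \<ge> 0}" using side closure_subset[of E] by auto
        show "closed {x. n \<bullet> (x - y0) \<ge> 0}" by (intro closed_Collect_le continuous_intros)
      qed
      then have t0: "t \<ge> 0" using z by (auto simp: frontier_def t_def)
      have tR: "t \<le> R" using tle[of z] zR by (simp add: t_def)
      have "H z = K * (R\<^sup>2 + 2 * (t * (R - t)))"
        by (simp add: H_def zR t_def power2_eq_square algebra_simps)
      moreover have "t * (R - t) \<ge> 0" using t0 tR by simp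
      ultimately have "H z \<ge> K * R\<^sup>2" using K0 by (simp add: mult_left_mono)
      moreover have "v z \<ge> - M" using M(2)[OF zc(1)] by linarith
      ultimately show ?thesis using K0 by linarith
    qed
  qed
  moreover have "H x \<le> M / 4"
  proof -
    have "(dist y0 x)\<^sup>2 \<le> (R / 16)\<^sup>2" using x R by (intro power_mono) auto
    moreover have "2 * R * (n \<bullet> (x - y0)) \<le> 2 * R * (R / 16)"
      using tle[of x] x R by (intro mult_left_mono) auto
    moreover have "(n \<bullet> (x - y0))\<^sup>2 \<ge> 0" by simp
    ultimately have "(dist y0 x)\<^sup>2 - 2 * (n \<bullet> (x - y0))\<^sup>2 + 2 * R * (n \<bullet> (x - y0)) \<le> (R / 16)\<^sup>2 + 2 * R * (R / 16)"
      by linarith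
    also have "\<dots> \<le> R\<^sup>2 / 6" by (simp add: power2_eq_square)
    finally have "H x \<le> K * (R\<^sup>2 / 6)" unfolding H_def using K0 by (intro mult_left_mono) auto
    then show ?thesis using K0 by simp
  qed
  ultimately show ?thesis by linarith
qed

section \<open>Geometry of mesh elements\<close>

lemma mesh_elementE:
  assumes m: "mesh_element \<rho> E xs" and \<rho>: "\<rho> > 0"
  obtains c r where "open E" "bounded E" "frontier E = (\<Union>i<length xs. edge xs i)"
    "star_shaped_wrt E (ball c r)" "\<rho> * diameter E < r" "0 < r" "r \<le> diameter E"
    "\<And>x y. x \<in> closure E \<Longrightarrow> y \<in> closure E \<Longrightarrow> dist x y \<le> diameter E"
proof -
  have poly: "is_polygon E xs" using m by (simp add: mesh_element_def)
  obtain c r where cr: "\<rho> * diameter E < r" "star_shaped_wrt E (ball c r)"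
    using m by (auto simp: mesh_element_def mesh_M1_def)
  have comp: "compact (\<Union>i<length xs. edge xs i)"
    by (intro compact_UN) (auto simp: edge_def)
  then have E: "open E" "bounded E"
    using poly by (simp_all add: is_polygon_def bounded_inside compact_imp_bounded compact_imp_closed open_inside)
  then have "0 \<le> diameter E" by (simp add: diameter_ge_0)
  then have r: "0 < r" using cr \<rho> by (smt (verit) mult_nonneg_nonneg)
  have sub: "ball c r \<subseteq> E" using cr by (auto simp: star_shaped_wrt_def)
  then have c: "c \<in> E" using r by auto
  have "\<forall>x\<in>E. closed_segment c x \<subseteq> E" using cr(2) r by (simp add: star_shaped_wrt_def)
  then have "starlike E" using c unfolding starlike_def by blast
  then have "frontier E = (\<Union>i<length xs. edge xs i)"
    using c by (intro polygon_frontier[OF poly]) (auto intro: starlike_imp_connected)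
  moreover have "r \<le> diameter E"
    using diameter_subset[OF sub E(2)] r by simp
  moreover have "dist x y \<le> diameter E" if "x \<in> closure E" "y \<in> closure E" for x y
    using diameter_bounded_bound[of "closure E" x y] that bounded_closure[OF E(2)] diameter_closure[OF E(2)] by simp
  ultimately show thesis using that E cr r by blast
qed

text \<open>
  Radius of the half discs, as a multiple of the diameter \<open>h\<close>. With \<open>R = disc_ratio \<rho> * h\<close>
  and \<open>r > \<rho> * h\<close>, the condition \<open>R * (1 + 2 * h / r) \<le> d\<close> of \<open>half_disc_at_edge\<close> holds for
  \<open>d = \<rho> * h / 8\<close>.
\<close>
definition disc_ratio :: "real \<Rightarrow> real" where
  "disc_ratio \<rho> = \<rho>\<^sup>2 / (8 * (\<rho> + 2))"

lemma mesh_half_disc: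
  assumes m: "mesh_element \<rho> E xs" and \<rho>: "\<rho> > 0" and i: "i < length xs"
    and y0: "y0 \<in> edge xs i" "\<rho> * diameter E / 8 \<le> dist y0 (xs ! i)"
      "\<rho> * diameter E / 8 \<le> dist y0 (xs ! (Suc i mod length xs))"
  obtains n where "norm n = 1" "\<And>z. z \<in> edge xs i \<Longrightarrow> n \<bullet> (z - y0) = 0"
    "\<And>x. x \<in> closure E \<Longrightarrow> dist y0 x < disc_ratio \<rho> * diameter E \<Longrightarrow> n \<bullet> (x - y0) \<ge> 0"
    "frontier E \<inter> ball y0 (disc_ratio \<rho> * diameter E) \<subseteq> edge xs i"
proof -
  let ?h = "diameter E" and ?R = "disc_ratio \<rho> * diameter E"
  obtain c r where E: "open E" "bounded E" and fr: "frontier E = (\<Union>i<length xs. edge xs i)"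
    and star: "star_shaped_wrt E (ball c r)" and r: "\<rho> * ?h < r" "0 < r" "r \<le> ?h"
    and d: "\<And>x y. x \<in> closure E \<Longrightarrow> y \<in> closure E \<Longrightarrow> dist x y \<le> ?h"
    by (rule mesh_elementE[OF m \<rho>]) (rule that)
  have h: "?h > 0" using r by linarith
  have c: "c \<in> closure E"
    using star r closure_subset by (force simp: star_shaped_wrt_def)
  have R0: "?R > 0" using h \<rho> by (simp add: disc_ratio_def)
  have "disc_ratio \<rho> \<le> \<rho> / 2" using \<rho> by (simp add: disc_ratio_def field_simps power2_eq_square)
  then have "?R \<le> \<rho> / 2 * ?h" using h by (intro mult_right_mono) auto
  then have R2: "?R \<le> r / 2" using r(1) by linarith
  have "2 * ?h / r \<le> 2 / \<rho>" using r h \<rho> by (simp add: field_simps)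
  then have "?R * (1 + 2 * ?h / r) \<le> ?R * (1 + 2 / \<rho>)" using R0 by (intro mult_left_mono) auto
  also have "\<dots> = \<rho> * ?h / 8"
  proof -
    define p where "p = \<rho> + 2"
    have "1 + 2 / \<rho> = p / \<rho>" "p \<noteq> 0" using \<rho> by (simp_all add: p_def field_simps)
    then show ?thesis using \<rho> unfolding disc_ratio_def p_def[symmetric] by (simp add: power2_eq_square)
  qed
  finally have R3: "?R * (1 + 2 * ?h / r) \<le> \<rho> * ?h / 8" .
  have "dist (xs ! i) (xs ! (Suc i mod length xs)) \<ge> \<rho> * ?h"
    using m i by (simp add: mesh_element_def mesh_M2_def)
  then have ne: "xs ! i \<noteq> xs ! (Suc i mod length xs)" using \<rho> h
    by (metis dist_self linorder_not_less mult_pos_pos)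
  have sub: "closed_segment (xs ! i) (xs ! (Suc i mod length xs)) \<subseteq> frontier E"
    using fr i by (auto simp: edge_def)
  show thesis
    by (rule half_disc_at_edge[OF E(1) star r(2) d[OF _ c] ne sub y0[unfolded edge_def] R0 R2 R3])
      (assumption, rule that, auto simp: edge_def)
qed

text \<open>
  The midpoint of an edge is at least \<open>\<rho> * h / 2\<close> away from its ends, and the midpoint of another
  edge is not on it. By \<open>mesh_half_disc\<close> the midpoints are separated by \<open>disc_ratio \<rho> * h\<close>.
\<close>
lemma mesh_number_of_vertices:
  assumes m: "mesh_element \<rho> E xs" and \<rho>: "\<rho> > 0"
  shows "real (length xs) \<le> (2 * (1 + disc_ratio \<rho>) / disc_ratio \<rho>)\<^sup>2"
proof -
  let ?h = "diameter E" and ?R = "disc_ratio \<rho> * diameter E"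
  obtain c r where E: "open E" "bounded E" and fr: "frontier E = (\<Union>i<length xs. edge xs i)"
    and star: "star_shaped_wrt E (ball c r)" and r: "\<rho> * ?h < r" "0 < r" "r \<le> ?h"
    and d: "\<And>x y. x \<in> closure E \<Longrightarrow> y \<in> closure E \<Longrightarrow> dist x y \<le> ?h"
    by (rule mesh_elementE[OF m \<rho>]) (rule that)
  have h: "?h > 0" using r by linarith
  have c: "c \<in> closure E"
    using star r closure_subset by (force simp: star_shaped_wrt_def)
  have R0: "?R > 0" using h \<rho> by (simp add: disc_ratio_def)
  define y where "y i = midpoint (xs ! i) (xs ! (Suc i mod length xs))" for i
  have len: "\<rho> * ?h \<le> dist (xs ! i) (xs ! (Suc i mod length xs))" if "i < length xs" for i
    using m that by (simp add: mesh_element_def mesh_M2_def)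
  have yd: "dist (y i) (xs ! i) = dist (xs ! i) (xs ! (Suc i mod length xs)) / 2"
    "dist (y i) (xs ! (Suc i mod length xs)) = dist (xs ! i) (xs ! (Suc i mod length xs)) / 2" for i
    unfolding y_def by (simp_all add: dist_midpoint)
  have \<rho>h: "\<rho> * ?h > 0" using \<rho> h by simp
  have ye: "y i \<in> edge xs i" for i
    by (simp add: y_def edge_def)
  have "real (length xs) \<le> (2 * (?h + ?R) / ?R)\<^sup>2"
  proof (rule card_separated_le[of _ _ _ c y])
    show "dist c (y i) \<le> ?h" if "i < length xs" for i
      using d[OF c] ye[of i] fr that by (auto simp: frontier_def)
    fix i j assume ij: "i < length xs" "j < length xs" "i \<noteq> j"
    show "?R \<le> dist (y i) (y j)"
    proof (rule ccontr)
      assume lt: "\<not> ?thesis"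
      have "\<rho> * ?h / 8 \<le> dist (y i) (xs ! i)" "\<rho> * ?h / 8 \<le> dist (y i) (xs ! (Suc i mod length xs))"
        using len[OF ij(1)] \<rho>h unfolding yd by linarith+
      then obtain n where "frontier E \<inter> ball (y i) ?R \<subseteq> edge xs i"
        using mesh_half_disc[OF m \<rho> ij(1) ye] by metis
      moreover have "y j \<in> frontier E \<inter> ball (y i) ?R" using ye fr ij lt by auto
      ultimately have "y j \<in> edge xs i \<inter> edge xs j" using ye by blast
      also have "\<dots> = edge_ends xs i \<inter> edge_ends xs j"
        using m ij by (simp add: mesh_element_def is_polygon_def nonintersecting_def)
      finally have "dist (y j) (xs ! j) = 0 \<or> dist (y j) (xs ! (Suc j mod length xs)) = 0"
        by (auto simp: edge_ends_def)
      then show False using len[OF ij(2)] \<rho>h unfolding yd by linarith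
    qed
  qed (use R0 h in auto)
  also have "2 * (?h + ?R) / ?R = 2 * (1 + disc_ratio \<rho>) / disc_ratio \<rho>"
  proof -
    have "2 * (?h + ?R) = (2 * (1 + disc_ratio \<rho>)) * ?h" by (simp add: algebra_simps)
    then show ?thesis using h by simp
  qed
  finally show ?thesis .
qed

lemma P1_on_segment:
  assumes "q \<in> P1"
  shows "q (A + s *\<^sub>R (B - A)) = (1 - s) * q A + s * q B"
  using assms by (auto simp: P1_def inner_add_right inner_diff_right algebra_simps)

lemma edge_param:
  "z \<in> edge xs i \<longleftrightarrow> (\<exists>s. 0 \<le> s \<and> s \<le> 1 \<and> z = xs ! i + s *\<^sub>R (xs ! (Suc i mod length xs) - xs ! i))"
  unfolding edge_def closed_segment_def by (auto simp: algebra_simps)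

text \<open>
  An inverse estimate: the largest vertex value of a discrete harmonic function is attained, up to a
  factor 4, on a disc of radius proportional to the diameter. The estimate concerns one sign of \<open>v\<close>;
  it is applied to \<open>v\<close> or \<open>- v\<close>.
\<close>
lemma vertex_inverse_estimate:
  assumes m: "mesh_element \<rho> E xs" and \<rho>: "\<rho> > 0"
    and v: "continuous_on (closure E) v" "harmonic_in E v"
      "\<And>i. i < length xs \<Longrightarrow> \<exists>q\<in>P1. \<forall>y\<in>edge xs i. v y = q y"
    and M: "\<And>j. j < length xs \<Longrightarrow> \<bar>v (xs ! j)\<bar> \<le> v (xs ! i)"
    and i: "i < length xs" "v (xs ! i) \<ge> 0"
  obtains a where "ball a (disc_ratio \<rho> / 32 * (\<rho> * diameter E)) \<subseteq> E"
    "\<And>x. x \<in> ball a (disc_ratio \<rho> / 32 * (\<rho> * diameter E)) \<Longrightarrow> v x \<ge> v (xs ! i) / 4"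
proof -
  let ?h = "diameter E" and ?R = "disc_ratio \<rho> * diameter E" and ?M = "v (xs ! i)"
  obtain c r where E: "open E" "bounded E" and fr: "frontier E = (\<Union>i<length xs. edge xs i)"
    and star: "star_shaped_wrt E (ball c r)" and r: "\<rho> * ?h < r" "0 < r" "r \<le> ?h"
    and d: "\<And>x y. x \<in> closure E \<Longrightarrow> y \<in> closure E \<Longrightarrow> dist x y \<le> ?h"
    by (rule mesh_elementE[OF m \<rho>]) (rule that)
  have h: "?h > 0" using r by linarith
  have R0: "?R > 0" using h \<rho> by (simp add: disc_ratio_def)
  have \<rho>1: "\<rho> < 1" using r h by (metis less_le_trans mult_le_cancel_right1 not_less order.asym)
  have \<kappa>: "0 < disc_ratio \<rho>" "disc_ratio \<rho> \<le> \<rho> / 8" "disc_ratio \<rho> < 1"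
  proof -
    show "0 < disc_ratio \<rho>" using \<rho> by (simp add: disc_ratio_def)
    show *: "disc_ratio \<rho> \<le> \<rho> / 8" using \<rho> by (simp add: disc_ratio_def field_simps power2_eq_square)
    show "disc_ratio \<rho> < 1" using * \<rho>1 by simp
  qed
  have modlt: "Suc j mod length xs < length xs" if "j < length xs" for j
    using that by (intro mod_less_divisor) linarith
  have frM: "\<bar>v z\<bar> \<le> ?M" if z: "z \<in> frontier E" for z
  proof -
    obtain j where j: "j < length xs" "z \<in> edge xs j" using z fr by blast
    obtain q where q: "q \<in> P1" "\<And>y. y \<in> edge xs j \<Longrightarrow> v y = q y" using v(3)[OF j(1)] by blast
    obtain s where s: "0 \<le> s" "s \<le> 1" "z = xs ! j + s *\<^sub>R (xs ! (Suc j mod length xs) - xs ! j)"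
      using j(2) unfolding edge_param by blast
    have e: "q (xs ! j) = v (xs ! j)" "q (xs ! (Suc j mod length xs)) = v (xs ! (Suc j mod length xs))"
      using q(2) by (simp_all add: edge_def)
    have "v z = (1 - s) * v (xs ! j) + s * v (xs ! (Suc j mod length xs))"
      using q(2)[OF j(2)] P1_on_segment[OF q(1)] s(3) e by metis
    also have "\<bar>\<dots>\<bar> \<le> (1 - s) * \<bar>v (xs ! j)\<bar> + s * \<bar>v (xs ! (Suc j mod length xs))\<bar>"
      using s by (intro order_trans[OF abs_triangle_ineq]) (simp add: abs_mult)
    also have "\<dots> \<le> (1 - s) * ?M + s * ?M"
      using s M[OF j(1)] M[OF modlt[OF j(1)]] by (intro add_mono mult_left_mono) auto
    finally show ?thesis by (simp add: algebra_simps)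
  qed
  have clM: "\<bar>v x\<bar> \<le> ?M" if x: "x \<in> closure E" for x
  proof (cases "x \<in> E")
    case True
    have "v x \<le> ?M"
      by (rule harmonic_maximum_principle[OF E v(1,2) _ True]) (use frM in force)
    moreover have "- v x \<le> ?M"
      by (rule harmonic_maximum_principle[OF E _ harmonic_in_uminus[OF v(2)] _ True])
        (use frM v(1) in \<open>force intro!: continuous_intros\<close>)+
    ultimately show ?thesis by linarith
  next
    case False
    then show ?thesis using frM x E by (simp add: frontier_def interior_open)
  qed
  let ?A = "xs ! i" and ?B = "xs ! (Suc i mod length xs)"
  define L where "L = norm (?B - ?A)"
  have L: "\<rho> * ?h \<le> L"
    using m i by (simp add: mesh_element_def mesh_M2_def L_def dist_norm norm_minus_commute)
  \<comment> \<open>The half disc around \<open>y0\<close> has radius at most \<open>L / 8\<close>, so its flat part stays in the first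
    quarter of the edge.\<close>
  define y0 where "y0 = ?A + (1 / 8) *\<^sub>R (?B - ?A)"
  have y0e: "y0 \<in> edge xs i" unfolding edge_param y0_def by (intro exI[of _ "1/8"]) simp
  have \<rho>h: "\<rho> * ?h > 0" using \<rho> h by simp
  have yA: "dist y0 ?A = L / 8" by (simp add: y0_def L_def dist_norm)
  have yB: "dist y0 ?B = 7 * L / 8"
  proof -
    have "y0 - ?B = - (7 / 8) *\<^sub>R (?B - ?A)"
      by (simp add: y0_def vec_eq_iff field_simps)
    then show ?thesis by (simp add: dist_norm L_def)
  qed
  obtain n where n: "norm n = 1" "\<And>z. z \<in> edge xs i \<Longrightarrow> n \<bullet> (z - y0) = 0"
    "\<And>x. x \<in> closure E \<Longrightarrow> dist y0 x < ?R \<Longrightarrow> n \<bullet> (x - y0) \<ge> 0"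
    "frontier E \<inter> ball y0 ?R \<subseteq> edge xs i"
  proof (rule mesh_half_disc[OF m \<rho> i(1) y0e])
    show "\<rho> * ?h / 8 \<le> dist y0 ?A" "\<rho> * ?h / 8 \<le> dist y0 ?B"
      using L \<rho>h unfolding yA yB by linarith+
  qed (rule that)
  have RL: "?R \<le> L / 8"
    using mult_right_mono[OF \<kappa>(2), of ?h] L h by linarith
  have flat: "n \<bullet> (z - y0) = 0 \<and> v z \<ge> ?M / 2" if z: "z \<in> frontier E" "dist y0 z < ?R" for z
  proof -
    have ze: "z \<in> edge xs i" using n(4) z by auto
    obtain q where q: "q \<in> P1" "\<And>y. y \<in> edge xs i \<Longrightarrow> v y = q y" using v(3)[OF i(1)] by blast
    obtain s where s: "0 \<le> s" "s \<le> 1" "z = ?A + s *\<^sub>R (?B - ?A)"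
      using ze unfolding edge_param by blast
    have e: "q ?A = v ?A" "q ?B = v ?B"
      using q(2) by (simp_all add: edge_def)
    have vz: "v z = (1 - s) * ?M + s * v ?B"
      using q(2)[OF ze] P1_on_segment[OF q(1)] s(3) e by metis
    have "y0 - z = (1 / 8 - s) *\<^sub>R (?B - ?A)" unfolding s(3) y0_def by (simp add: algebra_simps)
    then have "\<bar>1 / 8 - s\<bar> * L < L / 8" using z(2) RL by (simp add: dist_norm L_def)
    then have "\<bar>1 / 8 - s\<bar> * L < (1 / 8) * L" by simp
    then have "\<bar>1 / 8 - s\<bar> < 1 / 8" using L \<rho>h mult_less_cancel_right_pos[of L] by auto
    then have s4: "s \<le> 1 / 4" by linarith
    have "- ?M \<le> v ?B" using M[OF modlt[OF i(1)]] by linarith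
    then have "s * (- ?M) \<le> s * v ?B" using s by (intro mult_left_mono) auto
    moreover have "s * ?M \<le> 1 / 4 * ?M" using s4 i by (intro mult_right_mono) auto
    ultimately have "v z \<ge> ?M / 2" unfolding vz by (simp add: algebra_simps)
    with n(2)[OF ze] show ?thesis by simp
  qed
  \<comment> \<open>The homothety with centre \<open>y0\<close> and ratio \<open>l\<close> maps a ball around \<open>c\<close> to the desired disc.\<close>
  define l where "l = disc_ratio \<rho> / 32"
  have l: "0 < l" "l \<le> 1" using \<kappa> by (auto simp: l_def)
  define a where "a = (1 - l) *\<^sub>R y0 + l *\<^sub>R c"
  have y0c: "y0 \<in> closure E" using y0e fr i by (auto simp: frontier_def)
  have main: "x \<in> E \<and> dist y0 x < ?R / 16" if x: "x \<in> ball a (l * (\<rho> * ?h))" for x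
  proof -
    define b where "b = c + (1 / l) *\<^sub>R (x - a)"
    have "dist c b = (1 / l) * dist a x" using l by (simp add: b_def dist_norm norm_minus_commute)
    also have "\<dots> < (1 / l) * (l * (\<rho> * ?h))" using x l by (intro mult_strict_left_mono) auto
    also have "\<dots> < r" using l r by simp
    finally have b: "b \<in> ball c r" by simp
    have xb: "x = (1 - l) *\<^sub>R y0 + l *\<^sub>R b"
      using l by (simp add: b_def a_def scaleR_right_distrib)
    have "x \<in> E" unfolding xb by (rule star_shaped_closure[OF star y0c b l])
    moreover have "b \<in> closure E" using b star closure_subset by (force simp: star_shaped_wrt_def)
    then have "dist y0 b \<le> ?h" by (rule d[OF y0c])
    moreover have "y0 - x = l *\<^sub>R (y0 - b)" unfolding xb by (simp add: algebra_simps)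
    then have "dist y0 x = l * dist y0 b" using l by (simp add: dist_norm)
    ultimately have "dist y0 x \<le> l * ?h" using l by (simp add: mult_left_mono)
    also have "\<dots> < ?R / 16" using R0 unfolding l_def by linarith
    finally show ?thesis using \<open>x \<in> E\<close> by simp
  qed
  show thesis
  proof (rule that[of a])
    show "ball a (disc_ratio \<rho> / 32 * (\<rho> * ?h)) \<subseteq> E" using main unfolding l_def by blast
    show "v x \<ge> ?M / 4" if "x \<in> ball a (disc_ratio \<rho> / 32 * (\<rho> * ?h))" for x
      using main[of x] that harmonic_lower_bound_near_edge[OF E(1) v(1,2) i(2) clM R0 n(1,3) flat, of x]
      unfolding l_def by blast
  qed
qed

section \<open>The projection\<close>

lemma Pi_tilde_P1:
  assumes "mesh_element \<rho> E xs" "\<rho> > 0" "q \<in> P1"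
  shows "Pi_tilde E xs q = q"
  unfolding Pi_tilde_def
  by (rule the1_equality[OF Pi_tilde_ex1[OF assms(1,2)]]) (use assms(3) in \<open>simp add: vertex_ip_def\<close>)

text \<open>
  Pythagoras for the vertex inner product, whose weight is the positive area.
\<close>
lemma sum_Pi_tilde_square_le:
  assumes m: "mesh_element \<rho> E xs" "\<rho> > 0"
  shows "(\<Sum>i<length xs. (Pi_tilde E xs v (xs ! i))\<^sup>2) \<le> (\<Sum>i<length xs. (v (xs ! i))\<^sup>2)"
proof -
  let ?p = "Pi_tilde E xs v"
  have "vertex_ip E xs (\<lambda>x. v x - ?p x) ?p = 0"
    using Pi_tilde_projection[OF m] by blast
  then have "(\<Sum>i<length xs. (v (xs ! i) - ?p (xs ! i)) * ?p (xs ! i)) = 0"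
    using mesh_element_measure_pos[OF m] by (simp add: vertex_ip_def)
  moreover have "(\<Sum>i<length xs. (v (xs ! i))\<^sup>2) = (\<Sum>i<length xs. (?p (xs ! i))\<^sup>2)
      + 2 * (\<Sum>i<length xs. (v (xs ! i) - ?p (xs ! i)) * ?p (xs ! i))
      + (\<Sum>i<length xs. (v (xs ! i) - ?p (xs ! i))\<^sup>2)"
    unfolding sum_distrib_left sum.distrib[symmetric]
    by (intro sum.cong refl) (simp add: power2_eq_square algebra_simps)
  moreover have "(\<Sum>i<length xs. (v (xs ! i) - ?p (xs ! i))\<^sup>2) \<ge> 0" by (intro sum_nonneg) auto
  ultimately show ?thesis by linarith
qed

text \<open>
  The polygon lies in every convex set that contains its edges, in particular in the strip
  \<open>\<bar>q\<bar> \<le> K\<close>.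
\<close>
lemma P1_bounded_by_vertices:
  assumes poly: "is_polygon E xs" and q: "q \<in> P1" and K: "\<And>i. i < length xs \<Longrightarrow> \<bar>q (xs ! i)\<bar> \<le> K"
    and x: "x \<in> E"
  shows "\<bar>q x\<bar> \<le> K"
proof -
  obtain a b where ab: "q = (\<lambda>x. a + b \<bullet> x)" using q by (auto simp: P1_def)
  let ?H = "{x. b \<bullet> x \<le> K - a} \<inter> {x. b \<bullet> x \<ge> - K - a}"
  have cH: "convex ?H" by (intro convex_Int convex_halfspace_le convex_halfspace_ge)
  have vert: "xs ! i \<in> ?H" if "i < length xs" for i
    using K[OF that] by (auto simp: ab)
  have "edge xs i \<subseteq> ?H" if "i < length xs" for i
  proof -
    have "Suc i mod length xs < length xs"
      using that by (intro mod_less_divisor) linarith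
    then show ?thesis
      unfolding edge_def using that vert by (intro closed_segment_subset cH) blast+
  qed
  then have "(\<Union>i<length xs. edge xs i) \<subseteq> ?H" by blast
  then have "- ?H \<subseteq> outside (\<Union>i<length xs. edge xs i)"
    using cH by (intro outside_subset_convex)
  then have "E \<subseteq> ?H"
    using poly inside_Int_outside[of "\<Union>i<length xs. edge xs i"] unfolding is_polygon_def by blast
  then have "x \<in> ?H" using x by blast
  then show ?thesis by (auto simp: ab abs_le_iff)
qed

text \<open>
  The first factor is the square root of the bound on the number of vertices. The second one combines
  the loss of 4 in \<open>vertex_inverse_estimate\<close> with the ratio of the diameter to the radius of the disc
  in that lemma.
\<close>
definition stability_const :: "real \<Rightarrow> real" where
  "stability_const \<rho> = (2 * (1 + disc_ratio \<rho>) / disc_ratio \<rho>) * (4 / (disc_ratio \<rho> / 32 * \<rho>))"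

lemma L2_norm_Pi_tilde_le:
  assumes m: "mesh_element \<rho> E xs" and \<rho>: "\<rho> > 0" and v: "v \<in> V_h E xs"
  shows "L2_norm E (Pi_tilde E xs v) \<le> stability_const \<rho> * L2_norm E v"
proof -
  let ?h = "diameter E" and ?p = "Pi_tilde E xs v" and ?N = "length xs"
  obtain c r where E: "open E" "bounded E" and fr: "frontier E = (\<Union>i<length xs. edge xs i)"
    and star: "star_shaped_wrt E (ball c r)" and r: "\<rho> * ?h < r" "0 < r" "r \<le> ?h"
    and d: "\<And>x y. x \<in> closure E \<Longrightarrow> y \<in> closure E \<Longrightarrow> dist x y \<le> ?h"
    by (rule mesh_elementE[OF m \<rho>]) (rule that)
  have h: "?h > 0" using r by linarith
  have \<kappa>: "disc_ratio \<rho> > 0" using \<rho> by (simp add: disc_ratio_def)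
  define q where "q = disc_ratio \<rho> / 32 * (\<rho> * ?h)"
  have q0: "q > 0" using \<kappa> \<rho> h by (simp add: q_def)
  define n where "n = 2 * (1 + disc_ratio \<rho>) / disc_ratio \<rho>"
  have n0: "n > 0" using \<kappa> by (simp add: n_def)
  have Nn: "real ?N \<le> n\<^sup>2" using mesh_number_of_vertices[OF m \<rho>] by (simp add: n_def)
  have poly: "is_polygon E xs" using m by (simp add: mesh_element_def)
  then have N3: "?N \<ge> 3" by (simp add: is_polygon_def)
  define M where "M = Max ((\<lambda>i. \<bar>v (xs ! i)\<bar>) ` {..<?N})"
  have ne: "(\<lambda>i. \<bar>v (xs ! i)\<bar>) ` {..<?N} \<noteq> {}" using N3 by (auto simp: lessThan_empty_iff)
  have "M \<in> (\<lambda>i. \<bar>v (xs ! i)\<bar>) ` {..<?N}" unfolding M_def by (rule Max_in) (use ne in auto)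
  then obtain i where i: "i < ?N" "\<bar>v (xs ! i)\<bar> = M" by auto
  have Mle: "\<bar>v (xs ! j)\<bar> \<le> M" if "j < ?N" for j
    unfolding M_def by (rule Max_ge) (use that in auto)
  have M0: "M \<ge> 0" using i by auto
  let ?V = "measure lebesgue (ball (0::real^2) 1)"
  have vc: "continuous_on (closure E) v" "harmonic_in E v"
    "\<And>i. i < length xs \<Longrightarrow> \<exists>q\<in>P1. \<forall>y\<in>edge xs i. v y = q y"
    using v by (auto simp: V_h_def)
  have large: "\<exists>a. ball a q \<subseteq> E \<and> (\<forall>x\<in>ball a q. (v x)\<^sup>2 \<ge> (M / 4)\<^sup>2)"
  proof -
    consider "v (xs ! i) = M" | "- v (xs ! i) = M" using i M0 by linarith
    then show ?thesis
    proof cases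
      case 1
      obtain a where a: "ball a q \<subseteq> E" "\<And>x. x \<in> ball a q \<Longrightarrow> v x \<ge> v (xs ! i) / 4"
        unfolding q_def
        by (rule vertex_inverse_estimate[OF m \<rho> vc _ i(1)]) (use Mle 1 M0 that in auto)
      then have "(v x)\<^sup>2 \<ge> (M / 4)\<^sup>2" if "x \<in> ball a q" for x
        using that 1 M0 by (intro power_mono) auto
      with a(1) show ?thesis by blast
    next
      case 2
      have neg: "\<exists>q\<in>P1. \<forall>y\<in>edge xs j. - v y = q y" if j: "j < ?N" for j
      proof -
        obtain b where b: "b \<in> P1" "\<forall>y\<in>edge xs j. v y = b y" using vc(3)[OF j] by blast
        then obtain s t where st: "b = (\<lambda>x. s + t \<bullet> x)" by (auto simp: P1_def)
        have "(\<lambda>x. - s + (- t) \<bullet> x) \<in> P1" unfolding P1_def by blast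
        then show ?thesis by (rule bexI[rotated]) (use b st in simp)
      qed
      obtain a where a: "ball a q \<subseteq> E" "\<And>x. x \<in> ball a q \<Longrightarrow> - v x \<ge> - v (xs ! i) / 4"
        unfolding q_def
        by (rule vertex_inverse_estimate[OF m \<rho> _ harmonic_in_uminus[OF vc(2)] neg _ i(1)])
          (use Mle 2 M0 that vc(1) in \<open>auto intro: continuous_intros\<close>)
      then have "(- v x)\<^sup>2 \<ge> (M / 4)\<^sup>2" if "x \<in> ball a q" for x
        using that 2 M0 by (intro power_mono) auto
      with a(1) show ?thesis by auto
    qed
  qed
  then obtain a where a: "ball a q \<subseteq> E" "\<And>x. x \<in> ball a q \<Longrightarrow> (v x)\<^sup>2 \<ge> (M / 4)\<^sup>2" by blast
  have lower: "(M / 4)\<^sup>2 * (q\<^sup>2 * ?V) \<le> (LINT x:E|lebesgue. (v x)\<^sup>2)"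
  proof -
    have "set_integrable lebesgue E (\<lambda>x. (v x)\<^sup>2)" using v by (auto simp: V_h_def H1_def L2_def)
    then have "(LINT x|lebesgue. (M / 4)\<^sup>2 * indicator (ball a q) x) \<le> (LINT x:E|lebesgue. (v x)\<^sup>2)"
      unfolding set_lebesgue_integral_def set_integrable_def
    proof (intro integral_mono)
      show "integrable lebesgue (\<lambda>x. (M / 4)\<^sup>2 * indicator (ball a q) x)"
        by (intro integrable_mult_right integrable_real_indicator)
          (auto simp: emeasure_bounded_finite[simplified])
      show "(M / 4)\<^sup>2 * indicator (ball a q) x \<le> indicator E x *\<^sub>R (v x)\<^sup>2" for x
        using a(1) a(2)[of x] by (auto simp: indicator_def)
    qed
    moreover have "(LINT x|lebesgue. (M / 4)\<^sup>2 * indicator (ball a q) x) = (M / 4)\<^sup>2 * measure lebesgue (ball a q)"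
      by simp
    ultimately show ?thesis using measure_ball_plane[of q a] q0 by simp
  qed
  define S where "S = (\<Sum>i<?N. (?p (xs ! i))\<^sup>2)"
  have "S \<le> (\<Sum>i<?N. (v (xs ! i))\<^sup>2)" unfolding S_def by (rule sum_Pi_tilde_square_le[OF m \<rho>])
  also have "\<dots> \<le> (\<Sum>i<?N. M\<^sup>2)"
    using Mle M0 by (intro sum_mono) (simp add: abs_le_square_iff[symmetric])
  also have "\<dots> \<le> n\<^sup>2 * M\<^sup>2" using Nn by (simp add: mult_right_mono)
  finally have S: "S \<le> n\<^sup>2 * M\<^sup>2" .
  have S0: "S \<ge> 0" unfolding S_def by (intro sum_nonneg) auto
  have pS: "(?p x)\<^sup>2 \<le> S" if x: "x \<in> E" for x
  proof -
    have "\<bar>?p x\<bar> \<le> sqrt S"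
    proof (rule P1_bounded_by_vertices[OF poly Pi_tilde_projection(1)[OF m \<rho>] _ x])
      fix i assume "i < ?N"
      then have "(?p (xs ! i))\<^sup>2 \<le> S" unfolding S_def by (intro member_le_sum) auto
      then show "\<bar>?p (xs ! i)\<bar> \<le> sqrt S" using real_le_rsqrt real_sqrt_abs real_sqrt_le_mono by metis
    qed
    then show ?thesis using S0 by (metis abs_le_square_iff abs_of_nonneg real_sqrt_ge_zero real_sqrt_pow2)
  qed
  have c: "c \<in> closure E"
    using star r closure_subset[of E] by (auto simp: star_shaped_wrt_def)
  have mE: "measure lebesgue E \<le> ?h\<^sup>2 * ?V"
  proof -
    have "measure lebesgue E \<le> measure lebesgue (cball c ?h)"
      by (rule measure_mono_fmeasurable)
        (use d[OF c] closure_subset[of E] E in \<open>auto intro: lmeasurable_open[THEN fmeasurableD]\<close>)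
    also have "\<dots> = measure lebesgue (ball c ?h)"
      using content_cball_conv_ball[of c ?h] by (simp add: measure_completion)
    finally show ?thesis using measure_ball_plane[of ?h c] h by simp
  qed
  have "(LINT x:E|lebesgue. (?p x)\<^sup>2) \<le> (LINT x|lebesgue. S * indicator E x)"
    unfolding set_lebesgue_integral_def
  proof (rule integral_mono')
    show "integrable lebesgue (\<lambda>x. S * indicator E x)"
      using lmeasurable_open[OF E(2,1)] by (intro integrable_mult_right integrable_real_indicator)
        (auto simp: fmeasurable_def)
  qed (use pS S0 in \<open>auto simp: indicator_def\<close>)
  also have "\<dots> = S * measure lebesgue E" by simp
  also have "\<dots> \<le> (n\<^sup>2 * M\<^sup>2) * (?h\<^sup>2 * ?V)"
    using S mE S0 by (intro mult_mono) auto
  also have "\<dots> = (n * (4 / (disc_ratio \<rho> / 32 * \<rho>)))\<^sup>2 * ((M / 4)\<^sup>2 * (q\<^sup>2 * ?V))"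
    using \<kappa> \<rho> by (simp add: q_def power_mult_distrib power_divide field_simps)
  also have "\<dots> \<le> (n * (4 / (disc_ratio \<rho> / 32 * \<rho>)))\<^sup>2 * (LINT x:E|lebesgue. (v x)\<^sup>2)"
    by (rule mult_left_mono[OF lower]) simp
  finally have "(LINT x:E|lebesgue. (?p x)\<^sup>2) \<le> (stability_const \<rho>)\<^sup>2 * (LINT x:E|lebesgue. (v x)\<^sup>2)"
    by (simp add: stability_const_def n_def)
  moreover have "stability_const \<rho> \<ge> 0" using \<kappa> \<rho> by (simp add: stability_const_def)
  ultimately show ?thesis
    unfolding L2_norm_def by (metis abs_of_nonneg real_sqrt_abs real_sqrt_le_mono real_sqrt_mult)
qed

theorem lemma3p5:
  fixes \<rho> :: real
  assumes "\<rho> > 0"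
  shows "(\<forall>E xs. mesh_element \<rho> E xs \<longrightarrow>
            (\<forall>q\<in>P1. Pi_tilde E xs q = q) \<and>
            (\<forall>v\<in>V_h E xs. Pi_tilde E xs (Pi_tilde E xs v) = Pi_tilde E xs v))
       \<and> (\<exists>C>0. \<forall>E xs. mesh_element \<rho> E xs \<longrightarrow>
            (\<forall>v\<in>V_h E xs. L2_norm E (Pi_tilde E xs v) \<le> C * L2_norm E v))"
proof (intro conjI allI impI ballI exI[of _ "stability_const \<rho>"])
  show "stability_const \<rho> > 0"
    using assms by (simp add: stability_const_def disc_ratio_def add_pos_pos)
qed (use assms Pi_tilde_P1 Pi_tilde_projection(1) L2_norm_Pi_tilde_le in blast)+

end
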